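(* Let $q$ be a fixed power of $2$, and let $i_{GL}(n,q)$ denote the number of involutions in $GL(n,q)$. (1) As $n\to\infty$ through even integers, $$\lim_{n \rightarrow \infty} \frac{i_{GL}(n,q)}{q^{n^2/2}} = \frac{1}{2} \left[ \prod_{i \geq 1} \left(1+\frac{\sqrt{q}}{q^i}\right) + \prod_{i \geq 1} \left(1-\frac{\sqrt{q}}{q^i}\right) \right] = \prod_{i\ge 1} \frac{(1+q^{5-8i})(1+q^{3-8i})(1-q^{-8i})}{(1-q^{-2i})}.$$ (2) As $n\to\infty$ through odd integers, $$\lim_{n \rightarrow \infty} \frac{i_{GL}(n,q)}{q^{(n^2-1)/2}} = \frac{\sqrt{q}}{2} \left[ \prod_{i \geq 1} \left(1+\frac{\sqrt{q}}{q^i}\right) - \prod_{i \geq 1} \left(1-\frac{\sqrt{q}}{q^i}\right) \right] = \prod_{i\ge 1} \frac{(1+q^{7-8i})(1+q^{1-8i})(1-q^{-8i})}{(1-q^{-2i})}.$$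
   Context: $GL(n,q)$ is the group of invertible $n\times n$ matrices over the finite field with $q$ elements. "Involution" means an element $g$ with $g^2=1$ (the identity is counted). *)

theory Defs
  imports "Jordan_Normal_Form.Determinant" "HOL-Analysis.Infinite_Products"
begin

text \<open>
  The field with \<open>q\<close> elements is a finite field type \<open>'a\<close> with \<open>CARD('a) = q\<close>; the size \<open>n\<close> of
  the matrices is an ordinary natural number.
\<close>

definition GL :: "'a::field itself \<Rightarrow> nat \<Rightarrow> 'a mat monoid" where
  "GL ty n = units_of (ring_mat ty n ())"

text \<open>The identity counts as an involution.\<close>

definition involutions :: "('g, 'b) monoid_scheme \<Rightarrow> 'g set" where
  "involutions G = {g \<in> carrier G. g [^]\<^bsub>G\<^esub> (2::nat) = \<one>\<^bsub>G\<^esub>}"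

definition i_GL :: "'a::{field,finite} itself \<Rightarrow> nat \<Rightarrow> nat" where
  "i_GL ty n = card (involutions (GL ty n))"

lemma group_GL: "group (GL TYPE('a::field) n)"
proof -
  interpret ring "ring_mat TYPE('a) n ()" by (rule ring_mat)
  show ?thesis unfolding GL_def by (rule units_group)
qed

lemma carrier_GL: "carrier (GL TYPE('a::field) n) = {A \<in> carrier_mat n n. invertible_mat A}"
proof -
  have 1: "B \<in> carrier_mat n n"
    if "A \<in> carrier_mat n n" "A * B = 1\<^sub>m n" "B * A = 1\<^sub>m (dim_row B)" for A B :: "'a mat"
    using arg_cong[OF that(2), of dim_col] arg_cong[OF that(3), of dim_col] that(1)
    by (auto intro: carrier_matI)
  have 2: "dim_row B = n" "dim_row A = n" "dim_col A = n"
    if "B \<in> carrier_mat n n" "A \<in> carrier_mat n n" for A B :: "'a mat"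
    using that by auto
  show ?thesis
    unfolding GL_def units_of_carrier Units_def ring_mat_simps invertible_mat_def
      inverts_mat_def square_mat.simps
    using 1 2 by (intro Collect_cong) metis
qed

text \<open>All the sets counted by \<^const>\<open>i_GL\<close> are finite, so \<^const>\<open>card\<close> is their true size.\<close>

lemma finite_involutions_GL: "finite (involutions (GL TYPE('a::{field,finite}) n))"
proof (rule finite_subset)
  show "involutions (GL TYPE('a) n) \<subseteq>
      (\<lambda>f. Matrix.mat n n f) ` (({0..<n} \<times> {0..<n}) \<rightarrow>\<^sub>E (UNIV :: 'a set))"
  proof
    fix A assume "A \<in> involutions (GL TYPE('a) n)"
    then have "A \<in> carrier_mat n n" by (simp add: involutions_def carrier_GL)
    then have eq: "A = Matrix.mat n n (restrict (\<lambda>ij. A $$ ij) ({0..<n} \<times> {0..<n}))"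
      by (intro eq_matI) auto
    show "A \<in> (\<lambda>f. Matrix.mat n n f) ` (({0..<n} \<times> {0..<n}) \<rightarrow>\<^sub>E (UNIV :: 'a set))"
      by (rule image_eqI, rule eq) auto
  qed
  show "finite ((\<lambda>f. Matrix.mat n n f) ` (({0..<n} \<times> {0..<n}) \<rightarrow>\<^sub>E (UNIV :: 'a set)))"
    by (intro finite_imageI finite_PiE) auto
qed

lemma involutions_GL:
  "involutions (GL TYPE('a::field) n) = {A \<in> carrier_mat n n. invertible_mat A \<and> A * A = 1\<^sub>m n}"
proof -
  have "g [^]\<^bsub>GL TYPE('a) n\<^esub> (2::nat) = g * g" if "g \<in> carrier (GL TYPE('a) n)" for g
  proof -
    interpret group "GL TYPE('a) n" by (rule group_GL)
    show ?thesis using that by (simp add: numeral_2_eq_2) (simp add: GL_def units_of_mult ring_mat_simps)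
  qed
  then show ?thesis
    by (auto simp: involutions_def carrier_GL) (auto simp: GL_def units_of_one ring_mat_simps)
qed

end

theory Submission
  imports Defs "HOL-Analysis.Uniform_Limit"
begin

text \<open>
  In characteristic 2, \<open>A \<mapsto> A + 1\<close> turns involutions into matrices \<open>N\<close> with \<open>N\<^sup>2 = 0\<close>. Count pairs
  \<open>(N, v)\<close> with \<open>N v \<noteq> 0\<close>: after a change of basis moving \<open>(N v, v)\<close> to the first two unit vectors,
  \<open>N\<close> becomes block upper triangular with lower right block \<open>M\<close>, \<open>M\<^sup>2 = 0\<close>, of size \<open>n - 2\<close>, and
  is determined by \<open>M\<close> and one free row vector. This gives a recurrence for the number of \<open>N\<close> with
  kernel of given size, which solves to a product. With \<open>x = q\<^bsup>-1/2\<^esup>\<close> and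
  \<open>\<phi>\<^sub>m = \<Prod>\<^bsub>i\<le>m\<^esub> (1 - q\<^bsup>-i\<^esup>)\<close>,
  the number of involutions over \<open>q\<^bsup>n^2/2\<^esup>\<close> is the sum over \<open>t \<le> n\<close>, \<open>t \<equiv> n\<close> mod 2, of
  \<open>x\<^bsup>t^2\<^esup> \<phi>\<^sub>n / (\<phi>\<^bsub>(n-t)/2\<^esub> \<phi>\<^sub>t)\<close>. By Tannery's theorem the limit is the even or odd part (in \<open>x\<close>) of
  \<open>\<Sum> x\<^bsup>t^2\<^esup> / \<phi>\<^sub>t = \<Prod> (1 + x\<^bsup>2i-1\<^esup>)\<close>.
  For the product formulas, multiply by \<open>\<Prod> (1 - x\<^bsup>4i\<^esup>)\<close>: the Jacobi triple product turns the
  result into \<open>\<Sum>\<^bsub>k\<in>\<int>\<^esub> x\<^bsup>2k^2+k\<^esup>\<close>, whose terms of fixed parity are again a triple product.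
\<close>

section \<open>Euler's identity and the Jacobi triple product\<close>

definition qfact :: "real \<Rightarrow> nat \<Rightarrow> real" where
  "qfact y n = (\<Prod>i<n. 1 - y ^ Suc i)"

text \<open>The Gaussian binomial at base \<open>y\<close>, built from the q-Pochhammer symbol (y;
  y)_n = \<open>qfact y n\<close>. The explicit 0 for k > n matters: truncated subtraction would
  leave a nonzero quotient there, and the zero lets finite sums be read as series.\<close>

definition qbinom :: "real \<Rightarrow> nat \<Rightarrow> nat \<Rightarrow> real" where
  "qbinom y n k = (if k \<le> n then qfact y n / (qfact y k * qfact y (n - k)) else 0)"

lemma qfact_0 [simp]: "qfact y 0 = 1"
  by (simp add: qfact_def)

lemma qfact_Suc: "qfact y (Suc n) = qfact y n * (1 - y ^ Suc n)"
  by (simp add: qfact_def)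

lemma one_minus_power_pos: "0 < y \<Longrightarrow> y < 1 \<Longrightarrow> 0 < 1 - y ^ Suc n" for y :: real
  using power_Suc_less_one[of y n] by simp

lemma qfact_pos: "0 < y \<Longrightarrow> y < 1 \<Longrightarrow> 0 < qfact y n"
  unfolding qfact_def by (intro prod_pos ballI one_minus_power_pos)

lemma qfact_antimono:
  assumes "0 < y" "y < 1"
  shows "antimono (qfact y)"
proof (rule decseq_SucI)
  fix n
  show "qfact y (Suc n) \<le> qfact y n"
    unfolding qfact_Suc using qfact_pos[OF assms, of n] one_minus_power_pos[OF assms, of n] assms
    by (intro mult_right_le_one_le) auto
qed

lemma qfact_le_1: "0 < y \<Longrightarrow> y < 1 \<Longrightarrow> qfact y n \<le> 1"
  using antimonoD[OF qfact_antimono, of y 0 n] by simp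

text \<open>A q-Pascal rule. It comes from the splitting 1 - y^(n+1) = (1 - y^(n-k)) + y^(n-k) (1 -
  y^(k+1)) of the last factor of the numerator.\<close>

lemma qbinom_Suc_Suc:
  assumes "0 < y" "y < 1" "k \<le> n"
  shows "qbinom y (Suc n) (Suc k) = qbinom y n (Suc k) + y ^ (n - k) * qbinom y n k"
proof (cases "k = n")
  case True
  then show ?thesis
    using qfact_pos[OF assms(1,2), of n] qfact_pos[OF assms(1,2), of "Suc n"]
    by (simp add: qbinom_def)
next
  case False
  then obtain d where n: "n = Suc (k + d)"
    using assms(3) less_imp_Suc_add by (metis le_neq_implies_less)
  have nz: "qfact y k \<noteq> 0" "qfact y d \<noteq> 0" "1 - y ^ Suc k \<noteq> 0" "1 - y ^ Suc d \<noteq> 0"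
    using qfact_pos[OF assms(1,2)] one_minus_power_pos[OF assms(1,2)] by (metis less_irrefl)+
  have *: "F * (A + c * B) / ((K * B) * (D * A)) = F / ((K * B) * D) + c * (F / (K * (D * A)))"
    if "K \<noteq> 0" "D \<noteq> 0" "B \<noteq> 0" "A \<noteq> 0" for A B c D F K :: real
    using that by (simp add: field_simps)
  have [simp]: "Suc (k + d) - k = Suc d" by simp
  have "qbinom y (Suc n) (Suc k) =
      qfact y n * (1 - y ^ Suc n) / ((qfact y k * (1 - y ^ Suc k)) * (qfact y d * (1 - y ^ Suc d)))"
    by (simp add: qbinom_def n qfact_Suc[of _ k] qfact_Suc[of _ d] qfact_Suc[of _ "Suc (k + d)"]
        del: power_Suc)
  also have "1 - y ^ Suc n = (1 - y ^ Suc d) + y ^ Suc d * (1 - y ^ Suc k)"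
    by (simp add: n algebra_simps power_add)
  also have "qfact y n * \<dots> / ((qfact y k * (1 - y ^ Suc k)) * (qfact y d * (1 - y ^ Suc d))) =
     qfact y n / ((qfact y k * (1 - y ^ Suc k)) * qfact y d)
     + y ^ Suc d * (qfact y n / (qfact y k * (qfact y d * (1 - y ^ Suc d))))"
    by (rule *[OF nz])
  also have "\<dots> = qbinom y n (Suc k) + y ^ (n - k) * qbinom y n k"
    by (simp add: qbinom_def n qfact_Suc[of _ k] qfact_Suc[of _ d] del: power_Suc)
  finally show ?thesis .
qed

lemma qbinom_0 [simp]: "0 < y \<Longrightarrow> y < 1 \<Longrightarrow> qbinom y n 0 = 1"
  using qfact_pos[of y n] by (simp add: qbinom_def)

text \<open>Induction on n by the q-Pascal rule. With base y = x^2 the usual weight y^(k(k-1)/2) x^k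
  is just x^(k^2), so working with the square root \<open>x\<close> of the base avoids
  half-integers.\<close>

lemma qbinomial_theorem:
  fixes x z :: real
  assumes "0 < x" "x < 1"
  shows "(\<Prod>i<n. 1 + z * x ^ (2 * i + 1)) = (\<Sum>k\<le>n. qbinom (x\<^sup>2) n k * x ^ k\<^sup>2 * z ^ k)"
proof (induction n)
  case 0
  then show ?case by (simp add: qbinom_def)
next
  case (Suc n)
  have y: "0 < x\<^sup>2" "x\<^sup>2 < 1"
    using assms by (simp_all add: power_less_one_iff)
  let ?b = "\<lambda>n k. qbinom (x\<^sup>2) n k * x ^ k\<^sup>2 * z ^ k"
  have step: "?b (Suc n) (Suc k) = ?b n (Suc k) + ?b n k * (z * x ^ (2 * n + 1))" if "k \<le> n" for k
  proof -
    \<comment> \<open>The weight y^(n-k) of the q-Pascal rule turns x^((k+1)^2) into x^(k^2) times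
      the power of x in the new factor.\<close>
    have e: "(Suc k)\<^sup>2 + 2 * (n - k) = k\<^sup>2 + (2 * n + 1)"
      using that by (auto simp: power2_eq_square algebra_simps dest!: le_Suc_ex)
    have "(x\<^sup>2) ^ (n - k) * x ^ (Suc k)\<^sup>2 = x ^ k\<^sup>2 * x ^ (2 * n + 1)"
      unfolding power_mult[symmetric] power_add[symmetric] e[symmetric] by (simp add: add.commute)
    then show ?thesis
      by (simp add: qbinom_Suc_Suc[OF y that] algebra_simps)
  qed
  have "(\<Sum>k\<le>Suc n. ?b (Suc n) k) = 1 + (\<Sum>k\<le>n. ?b (Suc n) (Suc k))"
    using y by (subst sum.atMost_Suc_shift) simp
  also have "(\<Sum>k\<le>n. ?b (Suc n) (Suc k)) =
      (\<Sum>k\<le>n. ?b n (Suc k)) + (\<Sum>k\<le>n. ?b n k * (z * x ^ (2 * n + 1)))"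
    unfolding sum.distrib[symmetric] by (intro sum.cong refl step) simp
  also have "1 + ((\<Sum>k\<le>n. ?b n (Suc k)) + (\<Sum>k\<le>n. ?b n k * (z * x ^ (2 * n + 1)))) =
      (\<Sum>k\<le>Suc n. ?b n k) + (\<Sum>k\<le>n. ?b n k) * (z * x ^ (2 * n + 1))"
    using y by (subst sum.atMost_Suc_shift) (simp add: sum_distrib_right)
  \<comment> \<open>The extra term k = n + 1 is zero by the default value of
    \<open>qbinom\<close>.\<close>
  also have "(\<Sum>k\<le>Suc n. ?b n k) = (\<Sum>k\<le>n. ?b n k)"
    by (simp add: qbinom_def)
  finally show ?case
    unfolding prod.lessThan_Suc Suc.IH by (simp only: distrib_left mult_1_right)
qed

section \<open>Infinite products, uniform bounds and Euler's identity\<close>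

text \<open>Absolute convergence by comparison with a geometric series in x^a. No sign condition on
  \<open>c\<close> is imposed, because \<open>convergent_prod\<close> tolerates finitely many zero
  factors.\<close>

lemma convergent_prod_one_plus_powers:
  fixes c x :: real
  assumes "0 < x" "x < 1" "a > 0"
  shows "convergent_prod (\<lambda>i. 1 + c * x ^ (a * i + b))"
proof -
  have "summable (\<lambda>i. \<bar>c\<bar> * x ^ b * (x ^ a) ^ i)"
    using assms by (intro summable_mult summable_geometric) (simp add: power_less_one_iff)
  moreover have "(\<lambda>i. \<bar>c\<bar> * x ^ b * (x ^ a) ^ i) = (\<lambda>i. norm (1 + c * x ^ (a * i + b) - 1))"
    using assms by (auto simp: abs_mult power_add simp flip: power_mult)
  ultimately have "summable (\<lambda>i. norm (1 + c * x ^ (a * i + b) - 1))"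
    by simp
  then show ?thesis
    by (intro abs_convergent_prod_imp_convergent_prod summable_imp_abs_convergent_prod)
qed

lemma convergent_prod_tendsto:
  fixes f :: "nat \<Rightarrow> real"
  assumes "convergent_prod f"
  shows "(\<lambda>n. \<Prod>i<n. f i) \<longlonglongrightarrow> prodinf f"
  using convergent_prod_LIMSEQ[OF assms] by (subst filterlim_sequentially_Suc[symmetric]) (simp add: lessThan_Suc_atMost)

lemma qfact_tendsto:
  fixes y :: real
  assumes "0 < y" "y < 1"
  shows "qfact y \<longlonglongrightarrow> (\<Prod>i. 1 - y ^ Suc i)"
  using convergent_prod_tendsto[OF convergent_prod_one_plus_powers[OF assms, where a = 1 and b = 1 and c = "- 1"]]
  by (simp add: qfact_def[abs_def])

text \<open>A limit of positive numbers is only nonnegative; that it is nonzero comes from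
  convergence of the product, whose factors are all nonzero.\<close>

lemma qfact_limit_pos:
  fixes y :: real
  assumes "0 < y" "y < 1"
  shows "0 < (\<Prod>i. 1 - y ^ Suc i)"
proof -
  have c: "convergent_prod (\<lambda>i. 1 - y ^ Suc i)"
    using convergent_prod_one_plus_powers[OF assms, where a = 1 and b = 1 and c = "- 1"] by simp
  have "(\<Prod>i. 1 - y ^ Suc i) \<noteq> 0"
    using prodinf_nonzero[OF c] one_minus_power_pos[OF assms] by (metis less_irrefl)
  moreover have "(\<Prod>i. 1 - y ^ Suc i) \<ge> 0"
    using qfact_tendsto[OF assms] qfact_pos[OF assms] by (intro LIMSEQ_le_const) (auto intro: less_imp_le)
  ultimately show ?thesis by simp
qed

lemma qfact_ge_limit:
  fixes y :: real
  assumes "0 < y" "y < 1"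
  shows "(\<Prod>i. 1 - y ^ Suc i) \<le> qfact y n"
  using decseq_ge[OF qfact_antimono[OF assms] qfact_tendsto[OF assms]] .

text \<open>The numerator is at most 1 and each factor of the denominator is at least the infinite
  product. Since n, k and m are unrelated, the bound serves as domination both for Gaussian
  binomials and for the coefficients in the count of involutions.\<close>

lemma qfact_ratio_le:
  fixes y :: real
  assumes "0 < y" "y < 1"
  shows "\<bar>qfact y n / (qfact y k * qfact y m)\<bar> \<le> 1 / (\<Prod>i. 1 - y ^ Suc i)\<^sup>2"
proof -
  have "\<bar>qfact y n / (qfact y k * qfact y m)\<bar> = qfact y n / (qfact y k * qfact y m)"
    using qfact_pos[OF assms] by (simp add: less_imp_le)
  also have "\<dots> \<le> 1 / (\<Prod>i. 1 - y ^ Suc i)\<^sup>2"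
    unfolding power2_eq_square
    using qfact_pos[OF assms] qfact_limit_pos[OF assms] qfact_ge_limit[OF assms] qfact_le_1[OF assms]
    by (intro frac_le mult_mono) (auto intro: less_imp_le)
  finally show ?thesis .
qed

lemma qbinom_bound:
  fixes y :: real
  assumes "0 < y" "y < 1"
  shows "\<bar>qbinom y n k\<bar> \<le> 1 / (\<Prod>i. 1 - y ^ Suc i)\<^sup>2"
  using qfact_ratio_le[OF assms] by (simp add: qbinom_def)

text \<open>The k-th term is (x^k w)^k up to sign, and x^k |w| drops below 1/2 eventually, whatever
  \<open>w\<close> is.\<close>

lemma summable_theta:
  fixes x w :: real
  assumes "0 < x" "x < 1"
  shows "summable (\<lambda>k. x ^ k\<^sup>2 * w ^ k)"
proof (rule summable_comparison_test_ev)
  have "(\<lambda>k. x ^ k * \<bar>w\<bar>) \<longlonglongrightarrow> 0 * \<bar>w\<bar>"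
    using assms by (intro tendsto_intros LIMSEQ_realpow_zero) auto
  then have "eventually (\<lambda>k. x ^ k * \<bar>w\<bar> < 1 / 2) sequentially"
    by (intro order_tendstoD) auto
  then show "eventually (\<lambda>k. norm (x ^ k\<^sup>2 * w ^ k) \<le> (1 / 2) ^ k) sequentially"
  proof eventually_elim
    case (elim k)
    have "norm (x ^ k\<^sup>2 * w ^ k) = (x ^ k * \<bar>w\<bar>) ^ k"
      using assms by (simp add: abs_mult power_abs power_mult_distrib power2_eq_square power_mult)
    also have "\<dots> \<le> (1 / 2) ^ k"
      using elim assms by (intro power_mono) auto
    finally show ?case .
  qed
qed (auto intro: summable_geometric)

text \<open>Tannery's theorem with domination at every index. The filter is left general because the
  final limits run along the even or the odd numbers.\<close>

lemma tannery_uniform: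
  fixes a :: "nat \<Rightarrow> _ \<Rightarrow> real"
  assumes "\<And>k. ((\<lambda>n. a k n) \<longlongrightarrow> b k) F" "\<And>k n. \<bar>a k n\<bar> \<le> M k" "summable M" "F \<noteq> bot"
  shows "((\<lambda>n. suminf (\<lambda>k. a k n)) \<longlongrightarrow> suminf b) F" "summable b"
proof -
  have "eventually (\<lambda>(k,n). norm (a k n) \<le> M k) (at_top \<times>\<^sub>F F)"
    using assms(2) by (simp add: case_prod_unfold)
  from tannerys_theorem[OF assms(1) this assms(3,4)]
  show "((\<lambda>n. suminf (\<lambda>k. a k n)) \<longlongrightarrow> suminf b) F" "summable b"
    by (auto intro: summable_norm_cancel)
qed

text \<open>Let n tend to infinity in the q-binomial theorem: \<open>qbinom\<close> tends to the
  reciprocal of \<open>qfact\<close> at k, and its uniform bound times a theta series dominates the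
  terms.\<close>

lemma
  fixes x z :: real
  assumes "0 < x" "x < 1"
  shows euler_product_sum:
      "(\<Sum>k. x ^ k\<^sup>2 * z ^ k / qfact (x\<^sup>2) k) = (\<Prod>i. 1 + z * x ^ (2 * i + 1))"
    and summable_euler: "summable (\<lambda>k. x ^ k\<^sup>2 * z ^ k / qfact (x\<^sup>2) k)"
proof -
  have y: "0 < x\<^sup>2" "x\<^sup>2 < 1"
    using assms by (simp_all add: power_less_one_iff)
  let ?P = "\<Prod>i. 1 - (x\<^sup>2) ^ Suc i"
  let ?a = "\<lambda>k n. qbinom (x\<^sup>2) n k * (x ^ k\<^sup>2 * z ^ k)"
  have lim: "(\<lambda>n. ?a k n) \<longlonglongrightarrow> x ^ k\<^sup>2 * z ^ k / qfact (x\<^sup>2) k" for k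
  proof -
    \<comment> \<open>For fixed k the factors at n and at n - k have the same nonzero limit, which
      cancels.\<close>
    have "(\<lambda>n. qfact (x\<^sup>2) n / (qfact (x\<^sup>2) k * qfact (x\<^sup>2) (n - k)) * (x ^ k\<^sup>2 * z ^ k)) \<longlonglongrightarrow>
       ?P / (qfact (x\<^sup>2) k * ?P) * (x ^ k\<^sup>2 * z ^ k)"
      using qfact_limit_pos[OF y] qfact_pos[OF y, of k]
      by (intro tendsto_intros qfact_tendsto[OF y] filterlim_compose[OF qfact_tendsto[OF y] filterlim_minus_const_nat_at_top])
         auto
    moreover have "eventually (\<lambda>n. qfact (x\<^sup>2) n / (qfact (x\<^sup>2) k * qfact (x\<^sup>2) (n - k)) * (x ^ k\<^sup>2 * z ^ k) = ?a k n) sequentially"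
      using eventually_ge_at_top[of k] by eventually_elim (simp add: qbinom_def)
    ultimately show ?thesis
      using qfact_limit_pos[OF y] by (simp add: tendsto_cong)
  qed
  have bound: "\<bar>?a k n\<bar> \<le> 1 / ?P\<^sup>2 * (x ^ k\<^sup>2 * \<bar>z\<bar> ^ k)" for k n
  proof -
    have "\<bar>?a k n\<bar> = \<bar>qbinom (x\<^sup>2) n k\<bar> * (x ^ k\<^sup>2 * \<bar>z\<bar> ^ k)"
      using assms by (simp add: abs_mult power_abs)
    also have "\<dots> \<le> 1 / ?P\<^sup>2 * (x ^ k\<^sup>2 * \<bar>z\<bar> ^ k)"
      using assms by (intro mult_right_mono qbinom_bound[OF y]) auto
    finally show ?thesis .
  qed
  note T = tannery_uniform[OF lim bound summable_mult[OF summable_theta[OF assms]] sequentially_bot]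
  show "summable (\<lambda>k. x ^ k\<^sup>2 * z ^ k / qfact (x\<^sup>2) k)"
    by (rule T(2))
  have "(\<Sum>k. ?a k n) = (\<Prod>i<n. 1 + z * x ^ (2 * i + 1))" for n
    unfolding qbinomial_theorem[OF assms]
    by (subst suminf_finite[of "{..n}"]) (auto simp: qbinom_def mult_ac)
  with T(1) have "(\<lambda>n. \<Prod>i<n. 1 + z * x ^ (2 * i + 1)) \<longlonglongrightarrow> (\<Sum>k. x ^ k\<^sup>2 * z ^ k / qfact (x\<^sup>2) k)"
    by simp
  moreover have "(\<lambda>n. \<Prod>i<n. 1 + z * x ^ (2 * i + 1)) \<longlonglongrightarrow> (\<Prod>i. 1 + z * x ^ (2 * i + 1))"
    by (intro convergent_prod_tendsto convergent_prod_one_plus_powers assms) auto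
  ultimately show "(\<Sum>k. x ^ k\<^sup>2 * z ^ k / qfact (x\<^sup>2) k) = (\<Prod>i. 1 + z * x ^ (2 * i + 1))"
    by (rule LIMSEQ_unique)
qed

section \<open>The Jacobi triple product\<close>

lemma prod_lessThan_add: "(\<Prod>i<n + m. f i) = (\<Prod>i<n. f i) * (\<Prod>j<m. f (n + j))"
  for f :: "nat \<Rightarrow> 'a::comm_monoid_mult"
  by (induction m) (simp_all add: mult.assoc)

lemma sum_lessThan_add: "(\<Sum>i<n + m. f i) = (\<Sum>i<n. f i) + (\<Sum>j<m. f (n + j))"
  for f :: "nat \<Rightarrow> 'a::comm_monoid_add"
  by (induction m) (simp_all add: add.assoc)

lemma prod_odd_powers: "(\<Prod>j<n. x ^ (2 * j + 1)) = (x::real) ^ n\<^sup>2"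
proof (induction n)
  case (Suc n)
  have "n\<^sup>2 + (2 * n + 1) = (Suc n)\<^sup>2"
    by (simp add: power2_eq_square)
  with Suc show ?case
    unfolding prod.lessThan_Suc by (metis power_add)
qed simp

text \<open>The q-binomial theorem for 2n factors at z / x^(2n). The last n factors are those in z,
  the first n become those in 1/z up to the constant \<open>c\<close>, and the summation index is
  recentred at n. The two sums on the right are the indices k \<ge> 0 and -(k+1) of one two-sided
  sum.\<close>

lemma finite_jacobi_triple_product:
  fixes x z :: real
  assumes "0 < x" "x < 1" "z \<noteq> 0"
  shows "(\<Prod>i<n. 1 + z * x ^ (2 * i + 1)) * (\<Prod>i<n. 1 + inverse z * x ^ (2 * i + 1)) =
    (\<Sum>k\<le>n. qbinom (x\<^sup>2) (2 * n) (n + k) * (x ^ k\<^sup>2 * z ^ k)) +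
    (\<Sum>k<n. qbinom (x\<^sup>2) (2 * n) (n - Suc k) * (x ^ (Suc k)\<^sup>2 * inverse z ^ Suc k))"
    (is "?P1 * ?P2 = ?S1 + ?S2")
proof -
  \<comment> \<open>The product of the factors z / x^(2j+1) for j < n, pulled out of the first half
    below.\<close>
  define c where "c = z ^ n / x ^ n\<^sup>2"
  let ?w = "z / x ^ (2 * n)"
  have c: "c \<noteq> 0" using assms by (simp add: c_def)
  have left: "(\<Prod>i<2 * n. 1 + ?w * x ^ (2 * i + 1)) = c * (?P1 * ?P2)"
  proof -
    have "(\<Prod>i<2 * n. 1 + ?w * x ^ (2 * i + 1)) =
        (\<Prod>i<n. 1 + ?w * x ^ (2 * i + 1)) * (\<Prod>i<n. 1 + ?w * x ^ (2 * (n + i) + 1))"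
      using prod_lessThan_add[of "\<lambda>i. 1 + ?w * x ^ (2 * i + 1)" n n] by (simp add: mult_2)
    also have "(\<Prod>i<n. 1 + ?w * x ^ (2 * (n + i) + 1)) = ?P1"
    proof (rule prod.cong[OF refl])
      fix i
      have "x ^ (2 * (n + i) + 1) = x ^ (2 * n) * x ^ (2 * i + 1)"
        by (simp add: algebra_simps flip: power_add)
      then show "1 + ?w * x ^ (2 * (n + i) + 1) = 1 + z * x ^ (2 * i + 1)"
        using assms by simp
    qed
    \<comment> \<open>Read backwards, the first half has factors 1 + z / x^(2j+1), from which z /
      x^(2j+1) is extracted.\<close>
    also have "(\<Prod>i<n. 1 + ?w * x ^ (2 * i + 1)) = (\<Prod>j<n. 1 + ?w * x ^ (2 * (n - Suc j) + 1))"
      by (rule prod.nat_diff_reindex[symmetric])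
    also have "\<dots> = (\<Prod>j<n. z / x ^ (2 * j + 1) * (1 + inverse z * x ^ (2 * j + 1)))"
    proof (rule prod.cong[OF refl])
      fix j assume "j \<in> {..<n}"
      then have "(2 * (n - Suc j) + 1) + (2 * j + 1) = 2 * n" by simp
      then have "x ^ (2 * n) = x ^ (2 * (n - Suc j) + 1) * x ^ (2 * j + 1)"
        by (metis power_add)
      then have "?w * x ^ (2 * (n - Suc j) + 1) = z / x ^ (2 * j + 1)"
        using assms by simp
      then show "1 + ?w * x ^ (2 * (n - Suc j) + 1) =
          z / x ^ (2 * j + 1) * (1 + inverse z * x ^ (2 * j + 1))"
        using assms by (simp add: distrib_left del: power_Suc)
    qed
    also have "\<dots> = c * ?P2"
      unfolding prod.distrib prod_dividef prod_odd_powers by (simp add: c_def)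
    finally show ?thesis by (simp only: mult_ac)
  qed
  \<comment> \<open>Completing the square: \<open>m\<close> is the distance of k from n and
    \<open>u\<close> stands for z^(k-n). The first condition is (k-n)^2 = m^2 without subtraction,
    so it applies on both sides of the centre.\<close>
  have pow: "x ^ k\<^sup>2 * ?w ^ k = c * (x ^ m\<^sup>2 * u)"
    if "k\<^sup>2 + n\<^sup>2 = m\<^sup>2 + 2 * n * k" "z ^ k = z ^ n * u" for k m u
  proof -
    have "x ^ k\<^sup>2 * x ^ n\<^sup>2 = x ^ m\<^sup>2 * x ^ (2 * n * k)"
      unfolding power_add[symmetric] that(1) ..
    then show ?thesis
      using assms that(2) by (simp add: c_def power_divide field_simps flip: power_mult)
  qed
  have right: "(\<Sum>k\<le>2 * n. qbinom (x\<^sup>2) (2 * n) k * x ^ k\<^sup>2 * ?w ^ k) = c * (?S1 + ?S2)"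
  proof -
    let ?f = "\<lambda>k. qbinom (x\<^sup>2) (2 * n) k * (x ^ k\<^sup>2 * ?w ^ k)"
    have "(\<Sum>k\<le>2 * n. ?f k) = (\<Sum>k<n. ?f k) + (\<Sum>k<Suc n. ?f (n + k))"
      using sum_lessThan_add[of ?f n "Suc n"] by (simp add: mult_2 lessThan_Suc_atMost)
    also have "(\<Sum>k<Suc n. ?f (n + k)) = (\<Sum>k\<le>n. c * (qbinom (x\<^sup>2) (2 * n) (n + k) * (x ^ k\<^sup>2 * z ^ k)))"
      unfolding lessThan_Suc_atMost
    proof (rule sum.cong[OF refl])
      fix k
      have "x ^ (n + k)\<^sup>2 * ?w ^ (n + k) = c * (x ^ k\<^sup>2 * z ^ k)"
        by (rule pow) (simp_all add: power2_eq_square algebra_simps power_add)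
      then show "?f (n + k) = c * (qbinom (x\<^sup>2) (2 * n) (n + k) * (x ^ k\<^sup>2 * z ^ k))"
        by (simp only: mult_ac)
    qed
    also have "(\<Sum>k<n. ?f k) = (\<Sum>k<n. ?f (n - Suc k))"
      by (rule sum.nat_diff_reindex[symmetric])
    also have "\<dots> = (\<Sum>k<n. c * (qbinom (x\<^sup>2) (2 * n) (n - Suc k) * (x ^ (Suc k)\<^sup>2 * inverse z ^ Suc k)))"
    proof (rule sum.cong[OF refl])
      fix k assume "k \<in> {..<n}"
      then obtain d where d: "n = Suc k + d"
        using less_imp_Suc_add by auto
      have "x ^ (n - Suc k)\<^sup>2 * ?w ^ (n - Suc k) = c * (x ^ (Suc k)\<^sup>2 * inverse z ^ Suc k)"
      proof (rule pow)
        show "(n - Suc k)\<^sup>2 + n\<^sup>2 = (Suc k)\<^sup>2 + 2 * n * (n - Suc k)"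
          unfolding d by (simp add: power2_eq_square algebra_simps)
        show "z ^ (n - Suc k) = z ^ n * inverse z ^ Suc k"
          using assms by (simp add: d power_add field_simps)
      qed
      then show "?f (n - Suc k) = c * (qbinom (x\<^sup>2) (2 * n) (n - Suc k) * (x ^ (Suc k)\<^sup>2 * inverse z ^ Suc k))"
        by (simp only: mult_ac)
    qed
    finally show ?thesis
      by (simp only: sum_distrib_left distrib_left add.commute mult.assoc)
  qed
  have "c * (?P1 * ?P2) = c * (?S1 + ?S2)"
    using qbinomial_theorem[OF assms(1,2), of ?w "2 * n"] unfolding left right .
  with c show ?thesis by simp
qed

text \<open>The limit of the finite form. Every coefficient tends to 1/P with P the infinite product
  at base x^2, which accounts for the factor P on the left. The right side is the sum of x^(k^2) z^k
  over all integers k, split into k \<ge> 0 and k < 0.\<close>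

lemma jacobi_triple_product:
  fixes x z :: real
  assumes "0 < x" "x < 1" "z \<noteq> 0"
  shows "(\<Prod>i. 1 - (x\<^sup>2) ^ Suc i) * ((\<Prod>i. 1 + z * x ^ (2 * i + 1)) * (\<Prod>i. 1 + inverse z * x ^ (2 * i + 1))) =
    (\<Sum>k. x ^ k\<^sup>2 * z ^ k) + (\<Sum>k. x ^ (Suc k)\<^sup>2 * inverse z ^ Suc k)"
proof -
  have y: "0 < x\<^sup>2" "x\<^sup>2 < 1"
    using assms by (simp_all add: power_less_one_iff)
  define P where "P = (\<Prod>i. 1 - (x\<^sup>2) ^ Suc i)"
  have P: "P > 0" "qfact (x\<^sup>2) \<longlonglongrightarrow> P"
    unfolding P_def using qfact_limit_pos[OF y] qfact_tendsto[OF y] by auto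
  have qlim: "(\<lambda>n. qfact (x\<^sup>2) (h n)) \<longlonglongrightarrow> P" if "filterlim h at_top sequentially" for h
    by (rule filterlim_compose[OF P(2) that])
  define a where "a = (\<lambda>k n. qbinom (x\<^sup>2) (2 * n) (n + k) * (x ^ k\<^sup>2 * z ^ k))"
  \<comment> \<open>The cut at k < n has to be explicit: for larger k the index n - (k+1) truncates
    to 0, where the Gaussian binomial is 1. In \<open>a\<close> the default value of
    \<open>qbinom\<close> does the same job.\<close>
  define b where "b = (\<lambda>k n. if k < n then
      qbinom (x\<^sup>2) (2 * n) (n - Suc k) * (x ^ (Suc k)\<^sup>2 * inverse z ^ Suc k) else 0)"
  have add: "filterlim (\<lambda>n. n + k) at_top sequentially" for k :: nat
    by (rule filterlim_add_const_nat_at_top)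
  have double: "filterlim (\<lambda>n::nat. 2 * n) at_top sequentially"
    by (rule mult_nat_left_at_top) simp
  have lim_a: "(\<lambda>n. a k n) \<longlonglongrightarrow> 1 / P * (x ^ k\<^sup>2 * z ^ k)" for k
  proof -
    have "(\<lambda>n. qfact (x\<^sup>2) (2 * n) / (qfact (x\<^sup>2) (n + k) * qfact (x\<^sup>2) (n - k)) * (x ^ k\<^sup>2 * z ^ k)) \<longlonglongrightarrow>
       P / (P * P) * (x ^ k\<^sup>2 * z ^ k)"
      using P(1) by (intro tendsto_intros qlim add double filterlim_minus_const_nat_at_top) auto
    moreover have "eventually (\<lambda>n. qfact (x\<^sup>2) (2 * n) / (qfact (x\<^sup>2) (n + k) * qfact (x\<^sup>2) (n - k)) * (x ^ k\<^sup>2 * z ^ k) = a k n) sequentially"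
      using eventually_ge_at_top[of k]
      by eventually_elim (simp add: qbinom_def a_def mult_2)
    ultimately show ?thesis
      using P(1) by (simp add: tendsto_cong)
  qed
  have lim_b: "(\<lambda>n. b k n) \<longlonglongrightarrow> 1 / P * (x ^ (Suc k)\<^sup>2 * inverse z ^ Suc k)" for k
  proof -
    let ?u = "x ^ (Suc k)\<^sup>2 * inverse z ^ Suc k"
    have "(\<lambda>n. qfact (x\<^sup>2) (2 * n) / (qfact (x\<^sup>2) (n - Suc k) * qfact (x\<^sup>2) (n + Suc k)) * ?u) \<longlonglongrightarrow>
       P / (P * P) * ?u"
      using P(1) by (intro tendsto_intros qlim add double filterlim_minus_const_nat_at_top) auto
    moreover have "eventually (\<lambda>n. qfact (x\<^sup>2) (2 * n) / (qfact (x\<^sup>2) (n - Suc k) * qfact (x\<^sup>2) (n + Suc k)) * ?u = b k n) sequentially"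
      using eventually_gt_at_top[of k]
    proof eventually_elim
      case (elim n)
      then have "2 * n - (n - Suc k) = n + Suc k" by simp
      with elim show ?case by (simp add: qbinom_def b_def)
    qed
    ultimately show ?thesis
      using P(1) by (simp add: tendsto_cong)
  qed
  have bound_a: "\<bar>a k n\<bar> \<le> 1 / P\<^sup>2 * (x ^ k\<^sup>2 * \<bar>z\<bar> ^ k)" for k n
  proof -
    have "\<bar>a k n\<bar> = \<bar>qbinom (x\<^sup>2) (2 * n) (n + k)\<bar> * (x ^ k\<^sup>2 * \<bar>z\<bar> ^ k)"
      using assms by (simp add: a_def abs_mult power_abs)
    also have "\<dots> \<le> 1 / P\<^sup>2 * (x ^ k\<^sup>2 * \<bar>z\<bar> ^ k)"
      unfolding P_def using assms by (intro mult_right_mono qbinom_bound[OF y]) auto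
    finally show ?thesis .
  qed
  have bound_b: "\<bar>b k n\<bar> \<le> 1 / P\<^sup>2 * (x ^ (Suc k)\<^sup>2 * \<bar>inverse z\<bar> ^ Suc k)" for k n
  proof (cases "k < n")
    case True
    have "\<bar>b k n\<bar> = \<bar>qbinom (x\<^sup>2) (2 * n) (n - Suc k)\<bar> * (x ^ (Suc k)\<^sup>2 * \<bar>inverse z\<bar> ^ Suc k)"
      using assms True by (simp add: b_def abs_mult power_abs)
    also have "\<dots> \<le> 1 / P\<^sup>2 * (x ^ (Suc k)\<^sup>2 * \<bar>inverse z\<bar> ^ Suc k)"
      unfolding P_def using assms by (intro mult_right_mono qbinom_bound[OF y]) auto
    finally show ?thesis .
  next
    case False
    then show ?thesis using assms by (simp add: b_def)
  qed
  have sum_a: "(\<Sum>k. a k n) = (\<Sum>k\<le>n. qbinom (x\<^sup>2) (2 * n) (n + k) * (x ^ k\<^sup>2 * z ^ k))" for n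
    unfolding a_def by (intro suminf_finite) (auto simp: qbinom_def)
  have sum_b: "(\<Sum>k. b k n) = (\<Sum>k<n. qbinom (x\<^sup>2) (2 * n) (n - Suc k) * (x ^ (Suc k)\<^sup>2 * inverse z ^ Suc k))" for n
    unfolding b_def by (subst suminf_finite[of "{..<n}"]) auto
  have summable_b: "summable (\<lambda>k. x ^ (Suc k)\<^sup>2 * w ^ Suc k)" for w
    using summable_theta[OF assms(1,2), of w] by (subst summable_Suc_iff)
  have "(\<lambda>n. (\<Sum>k. a k n) + (\<Sum>k. b k n)) \<longlonglongrightarrow>
      (\<Sum>k. 1 / P * (x ^ k\<^sup>2 * z ^ k)) + (\<Sum>k. 1 / P * (x ^ (Suc k)\<^sup>2 * inverse z ^ Suc k))"
    by (intro tendsto_add tannery_uniform(1)[OF lim_a bound_a] tannery_uniform(1)[OF lim_b bound_b]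
        summable_mult summable_b summable_theta assms sequentially_bot)
  also have "(\<lambda>n. (\<Sum>k. a k n) + (\<Sum>k. b k n)) =
      (\<lambda>n. (\<Prod>i<n. 1 + z * x ^ (2 * i + 1)) * (\<Prod>i<n. 1 + inverse z * x ^ (2 * i + 1)))"
    unfolding sum_a sum_b finite_jacobi_triple_product[OF assms] ..
  also have "(\<Sum>k. 1 / P * (x ^ k\<^sup>2 * z ^ k)) + (\<Sum>k. 1 / P * (x ^ (Suc k)\<^sup>2 * inverse z ^ Suc k)) =
      1 / P * ((\<Sum>k. x ^ k\<^sup>2 * z ^ k) + (\<Sum>k. x ^ (Suc k)\<^sup>2 * inverse z ^ Suc k))"
    by (simp only: suminf_mult summable_b summable_theta assms distrib_left)
  finally have 1: "(\<lambda>n. (\<Prod>i<n. 1 + z * x ^ (2 * i + 1)) * (\<Prod>i<n. 1 + inverse z * x ^ (2 * i + 1)))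
    \<longlonglongrightarrow> 1 / P * ((\<Sum>k. x ^ k\<^sup>2 * z ^ k) + (\<Sum>k. x ^ (Suc k)\<^sup>2 * inverse z ^ Suc k))" .
  have 2: "(\<lambda>n. (\<Prod>i<n. 1 + z * x ^ (2 * i + 1)) * (\<Prod>i<n. 1 + inverse z * x ^ (2 * i + 1)))
    \<longlonglongrightarrow> (\<Prod>i. 1 + z * x ^ (2 * i + 1)) * (\<Prod>i. 1 + inverse z * x ^ (2 * i + 1))"
    by (intro tendsto_mult convergent_prod_tendsto convergent_prod_one_plus_powers assms) auto
  show ?thesis
    using LIMSEQ_unique[OF 1 2] P(1) unfolding P_def[symmetric] by (simp add: field_simps)
qed

section \<open>Even and odd parts of the Euler product\<close>

lemma prod_lessThan_double: "(\<Prod>i<2 * n. f i) = (\<Prod>i<n. f (2 * i) * f (2 * i + 1))"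
  for f :: "nat \<Rightarrow> 'a::comm_monoid_mult"
  by (induction n) (simp_all add: mult.assoc)

text \<open>Adding or subtracting the alternating series kills the terms of one parity; reindexing
  along 2k or 2k+1 then drops only zeros.\<close>

lemma
  fixes f :: "nat \<Rightarrow> real"
  assumes "summable f" "\<And>k. 0 \<le> f k"
  shows suminf_even_part: "(\<Sum>k. f k) + (\<Sum>k. (- 1) ^ k * f k) = 2 * (\<Sum>k. f (2 * k))"
    and suminf_odd_part: "(\<Sum>k. f k) - (\<Sum>k. (- 1) ^ k * f k) = 2 * (\<Sum>k. f (2 * k + 1))"
proof -
  have alt: "summable (\<lambda>k. (- 1) ^ k * f k)"
    by (rule summable_comparison_test'[OF assms(1), of 0]) (simp add: abs_mult power_abs assms(2))
  have "(\<Sum>k. f (2 * k)) = (\<Sum>k. (f (2 * k) + (- 1) ^ (2 * k) * f (2 * k)) / 2)"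
    by simp
  also have "\<dots> = (\<Sum>k. (f k + (- 1) ^ k * f k) / 2)"
  proof (rule suminf_mono_reindex)
    fix n assume "n \<notin> range (\<lambda>k::nat. 2 * k)"
    then have "odd n" by (auto elim!: evenE)
    then show "(f n + (- 1) ^ n * f n) / 2 = 0" by simp
  qed (simp add: strict_mono_def)
  also have "\<dots> = ((\<Sum>k. f k) + (\<Sum>k. (- 1) ^ k * f k)) / 2"
    using assms alt by (simp add: suminf_add suminf_divide summable_add)
  finally show "(\<Sum>k. f k) + (\<Sum>k. (- 1) ^ k * f k) = 2 * (\<Sum>k. f (2 * k))"
    by simp
  have "(\<Sum>k. f (2 * k + 1)) = (\<Sum>k. (f (2 * k + 1) - (- 1) ^ (2 * k + 1) * f (2 * k + 1)) / 2)"
    by simp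
  also have "\<dots> = (\<Sum>k. (f k - (- 1) ^ k * f k) / 2)"
  proof (rule suminf_mono_reindex)
    fix n assume "n \<notin> range (\<lambda>k::nat. 2 * k + 1)"
    have "even n"
    proof (rule ccontr)
      assume "odd n"
      then obtain m where "n = 2 * m + 1" by (rule oddE)
      with \<open>n \<notin> _\<close> show False by auto
    qed
    then show "(f n - (- 1) ^ n * f n) / 2 = 0" by simp
  qed (simp add: strict_mono_def)
  also have "\<dots> = ((\<Sum>k. f k) - (\<Sum>k. (- 1) ^ k * f k)) / 2"
    using assms alt by (simp add: suminf_diff suminf_divide summable_diff)
  finally show "(\<Sum>k. f k) - (\<Sum>k. (- 1) ^ k * f k) = 2 * (\<Sum>k. f (2 * k + 1))"
    by simp
qed

text \<open>By the triple product, the first factor times \<open>E s\<close> is the sum of s^k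
  x^(2k^2+k) over all integers k. Taking \<open>E 1\<close> plus or minus \<open>E (- 1)\<close>
  keeps the even or the odd k; the surviving terms form a theta series with base x^8, which the
  triple product turns back into a product.\<close>

lemma even_odd_part_product:
  fixes x :: real
  assumes "0 < x" "x < 1"
  defines "E \<equiv> (\<lambda>s. \<Prod>i. 1 + s * x ^ (2 * i + 1))"
  shows "(\<Prod>i. 1 - x ^ (4 * i + 4)) * (E 1 + E (- 1)) =
      2 * ((\<Prod>i. 1 - x ^ (16 * i + 16)) * ((\<Prod>i. 1 + x ^ (16 * i + 10)) * (\<Prod>i. 1 + x ^ (16 * i + 6))))"
    and "(\<Prod>i. 1 - x ^ (4 * i + 4)) * (E 1 - E (- 1)) =
      2 * x * ((\<Prod>i. 1 - x ^ (16 * i + 16)) * ((\<Prod>i. 1 + x ^ (16 * i + 14)) * (\<Prod>i. 1 + x ^ (16 * i + 2))))"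
proof -
  \<comment> \<open>\<open>u\<close> and \<open>v\<close> are the terms x^(2j^2+j) of the two-sided
    series at j = k and at j = -(k+1).\<close>
  define u where "u = (\<lambda>k. x ^ (2 * k\<^sup>2 + k))"
  define v where "v = (\<lambda>k. x ^ (2 * k\<^sup>2 + 3 * k + 1))"
  have le_geometric: "summable (\<lambda>k. x ^ h k)" if "\<And>k. k \<le> h k" for h
  proof (rule summable_comparison_test')
    show "summable (\<lambda>k. x ^ k)"
      using assms by (intro summable_geometric) simp
    show "norm (x ^ h k) \<le> x ^ k" if "k \<ge> 0" for k
      using assms \<open>\<And>k. k \<le> h k\<close> by (simp add: power_decreasing)
  qed
  have summable_u: "summable u" and summable_v: "summable v"
    unfolding u_def v_def by (rule le_geometric; simp)+
  have u0: "0 \<le> u k" and v0: "0 \<le> v k" for k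
    using assms by (simp_all add: u_def v_def)
  \<comment> \<open>The triple product with base x^2 and z = s x. Its two products run over the
    exponents 4i+3 and 4i+1, and both carry the sign s because s is its own inverse.\<close>
  have E: "(\<Prod>i. 1 - x ^ (4 * i + 4)) * E s = (\<Sum>k. s ^ k * u k) + s * (\<Sum>k. s ^ k * v k)"
    if "s = 1 \<or> s = - 1" for s
  proof -
    have s: "s \<noteq> 0" "inverse s = s" using that by auto
    have z: "(s * x) * (x\<^sup>2) ^ (2 * i + 1) = s * x ^ (4 * i + 3)"
      "inverse (s * x) * (x\<^sup>2) ^ (2 * i + 1) = s * x ^ (4 * i + 1)" for i
    proof -
      have "(x\<^sup>2) ^ (2 * i + 1) = x ^ Suc (4 * i + 1)"
        unfolding power_mult[symmetric] by (rule arg_cong[of _ _ "\<lambda>m. x ^ m"]) simp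
      then show "(s * x) * (x\<^sup>2) ^ (2 * i + 1) = s * x ^ (4 * i + 3)"
          "inverse (s * x) * (x\<^sup>2) ^ (2 * i + 1) = s * x ^ (4 * i + 1)"
        using assms s by (simp_all add: eval_nat_numeral field_simps)
    qed
    have conv: "convergent_prod (\<lambda>i. 1 + s * x ^ (4 * i + 3))" "convergent_prod (\<lambda>i. 1 + s * x ^ (4 * i + 1))"
      "convergent_prod (\<lambda>i. 1 + s * x ^ (2 * i + 1))"
      using assms by (auto intro!: convergent_prod_one_plus_powers simp del: One_nat_def)
    \<comment> \<open>Partial products of even length split the odd exponents into the classes 1 and
      3 mod 4.\<close>
    have "(\<lambda>n. \<Prod>i<2 * n. 1 + s * x ^ (2 * i + 1)) \<longlonglongrightarrow> E s"
      unfolding E_def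
      by (rule filterlim_compose[OF convergent_prod_tendsto[OF conv(3)]]) (rule mult_nat_left_at_top, simp)
    moreover have "(\<Prod>i<2 * n. 1 + s * x ^ (2 * i + 1)) =
      (\<Prod>i<n. 1 + s * x ^ (4 * i + 1)) * (\<Prod>i<n. 1 + s * x ^ (4 * i + 3))" for n
      unfolding prod_lessThan_double prod.distrib[symmetric]
      by (intro prod.cong) (simp_all add: algebra_simps eval_nat_numeral)
    ultimately have "E s = (\<Prod>i. 1 + s * x ^ (4 * i + 1)) * (\<Prod>i. 1 + s * x ^ (4 * i + 3))"
      by (intro LIMSEQ_unique[OF _ tendsto_mult[OF convergent_prod_tendsto convergent_prod_tendsto]] conv) simp
    moreover have "(\<Prod>i. 1 - ((x\<^sup>2)\<^sup>2) ^ Suc i) = (\<Prod>i. 1 - x ^ (4 * i + 4))"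
      by (simp add: algebra_simps power_add flip: power_mult)
    ultimately have "(\<Prod>i. 1 - x ^ (4 * i + 4)) * E s =
        (\<Sum>k. (x\<^sup>2) ^ k\<^sup>2 * (s * x) ^ k) + (\<Sum>k. (x\<^sup>2) ^ (Suc k)\<^sup>2 * inverse (s * x) ^ Suc k)"
      using jacobi_triple_product[of "x\<^sup>2" "s * x"] assms s
      unfolding z by (simp only: mult_ac) (simp add: power_less_one_iff)
    also have "(\<lambda>k. (x\<^sup>2) ^ k\<^sup>2 * (s * x) ^ k) = (\<lambda>k. s ^ k * u k)"
      by (simp add: u_def power_mult_distrib power_add mult_ac flip: power_mult)
    also have "(\<lambda>k. (x\<^sup>2) ^ (Suc k)\<^sup>2 * inverse (s * x) ^ Suc k) = (\<lambda>k. s * (s ^ k * v k))"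
    proof
      fix k
      have "2 * (Suc k)\<^sup>2 = (2 * k\<^sup>2 + 3 * k + 1) + Suc k"
        by (simp add: power2_eq_square)
      then have "(x\<^sup>2) ^ (Suc k)\<^sup>2 = v k * x ^ Suc k"
        unfolding v_def power_add[symmetric] power_mult[symmetric] by simp
      moreover have "inverse (s * x) ^ Suc k = s ^ Suc k / x ^ Suc k"
        using s by (simp only: inverse_mult_distrib power_mult_distrib) (simp add: field_simps)
      ultimately show "(x\<^sup>2) ^ (Suc k)\<^sup>2 * inverse (s * x) ^ Suc k = s * (s ^ k * v k)"
        using assms by simp
    qed
    also have "(\<Sum>k. s * (s ^ k * v k)) = s * (\<Sum>k. s ^ k * v k)"
    proof (rule suminf_mult)
      show "summable (\<lambda>k. s ^ k * v k)"
        by (rule summable_comparison_test'[OF summable_v, of 0])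
           (use that assms in \<open>auto simp: v_def abs_mult power_abs\<close>)
    qed
    finally show ?thesis .
  qed
  have X: "0 < x ^ 8" "x ^ 8 < 1" using assms by (simp_all add: power_less_one_iff)
  have D: "(\<Prod>i. 1 - ((x ^ 8)\<^sup>2) ^ Suc i) = (\<Prod>i. 1 - x ^ (16 * i + 16))"
    by (simp add: algebra_simps power_add flip: power_mult)
  \<comment> \<open>The triple product with base x^8 and z = x^c, used for c = 2 and c = 6; c \<le>
    8 makes the subtractions genuine.\<close>
  have F: "(\<Prod>i. 1 - x ^ (16 * i + 16)) * ((\<Prod>i. 1 + x ^ (16 * i + (8 + c))) * (\<Prod>i. 1 + x ^ (16 * i + (8 - c)))) =
      (\<Sum>k. x ^ (8 * k\<^sup>2 + c * k)) + (\<Sum>k. x ^ (8 * k\<^sup>2 + (16 - c) * k + (8 - c)))" if "c \<le> 8" for c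
  proof -
    have "x ^ c * (x ^ 8) ^ (2 * i + 1) = x ^ (16 * i + (8 + c))" for i
      by (simp add: algebra_simps flip: power_mult power_add)
    moreover have "inverse (x ^ c) * (x ^ 8) ^ (2 * i + 1) = x ^ (16 * i + (8 - c))" for i
    proof -
      have "8 * (2 * i + 1) = 16 * i + (8 - c) + c" using that by simp
      then have "(x ^ 8) ^ (2 * i + 1) = x ^ (16 * i + (8 - c)) * x ^ c"
        by (metis power_add power_mult)
      then show ?thesis using assms by simp
    qed
    moreover have "(x ^ 8) ^ k\<^sup>2 * (x ^ c) ^ k = x ^ (8 * k\<^sup>2 + c * k)" for k
      by (simp add: power_add power_mult)
    moreover have "(x ^ 8) ^ (Suc k)\<^sup>2 * inverse (x ^ c) ^ Suc k = x ^ (8 * k\<^sup>2 + (16 - c) * k + (8 - c))" for k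
    proof -
      have "8 * (Suc k)\<^sup>2 = (8 * k\<^sup>2 + (16 - c) * k + (8 - c)) + c * Suc k"
      proof -
        have "(16 - c) * k + c * k = 16 * k" using that by (simp flip: add_mult_distrib)
        moreover have "8 * (Suc k)\<^sup>2 = 8 * k\<^sup>2 + 16 * k + 8" "c * Suc k = c * k + c"
          by (simp_all add: power2_eq_square)
        ultimately show ?thesis using that by linarith
      qed
      then have "(x ^ 8) ^ (Suc k)\<^sup>2 = x ^ (8 * k\<^sup>2 + (16 - c) * k + (8 - c)) * (x ^ c) ^ Suc k"
        by (metis power_add power_mult)
      then show ?thesis using assms by (simp add: power_inverse del: power_Suc)
    qed
    ultimately show ?thesis
      using jacobi_triple_product[OF X, of "x ^ c"] assms unfolding D by simp
  qed
  have nat_pow: "x ^ a = x ^ b" if "a = b" for a b :: nat using that by simp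
  note S = E[of 1, simplified] E[of "- 1", simplified]
  have "(\<Prod>i. 1 - x ^ (4 * i + 4)) * (E 1 + E (- 1)) =
    ((\<Sum>k. u k) + (\<Sum>k. (- 1) ^ k * u k)) + ((\<Sum>k. v k) - (\<Sum>k. (- 1) ^ k * v k))"
    using S by (simp only: distrib_left)
  \<comment> \<open>The integer -(k+1) is even exactly when k is odd, so the even part takes even
    indices of \<open>u\<close> and odd indices of \<open>v\<close>.\<close>
  also have "\<dots> = 2 * ((\<Sum>k. u (2 * k)) + (\<Sum>k. v (2 * k + 1)))"
    by (simp only: suminf_even_part[OF summable_u u0] suminf_odd_part[OF summable_v v0] distrib_left)
  also have "(\<lambda>k. u (2 * k)) = (\<lambda>k. x ^ (8 * k\<^sup>2 + 2 * k))"
    by (simp add: u_def power2_eq_square)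
  also have "(\<lambda>k. v (2 * k + 1)) = (\<lambda>k. x ^ (8 * k\<^sup>2 + (16 - 2) * k + (8 - 2)))"
    unfolding v_def by (intro ext nat_pow) (simp add: power2_eq_square algebra_simps)
  also note F[of 2, symmetric]
  finally show "(\<Prod>i. 1 - x ^ (4 * i + 4)) * (E 1 + E (- 1)) =
      2 * ((\<Prod>i. 1 - x ^ (16 * i + 16)) * ((\<Prod>i. 1 + x ^ (16 * i + 10)) * (\<Prod>i. 1 + x ^ (16 * i + 6))))"
    by simp
  have "(\<Prod>i. 1 - x ^ (4 * i + 4)) * (E 1 - E (- 1)) =
    ((\<Sum>k. u k) - (\<Sum>k. (- 1) ^ k * u k)) + ((\<Sum>k. v k) + (\<Sum>k. (- 1) ^ k * v k))"
    using S by (simp only: right_diff_distrib)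
  also have "\<dots> = 2 * ((\<Sum>k. v (2 * k)) + (\<Sum>k. u (2 * k + 1)))"
    by (simp only: suminf_odd_part[OF summable_u u0] suminf_even_part[OF summable_v v0] distrib_left add.commute)
  \<comment> \<open>One factor x is taken out of every term so that the remaining exponents fit
    \<open>F\<close> with c = 6.\<close>
  also have "(\<lambda>k. v (2 * k)) = (\<lambda>k. x * x ^ (8 * k\<^sup>2 + 6 * k))"
    unfolding v_def power_Suc[symmetric] by (intro ext nat_pow) (simp add: power2_eq_square algebra_simps)
  also have "(\<lambda>k. u (2 * k + 1)) = (\<lambda>k. x * x ^ (8 * k\<^sup>2 + (16 - 6) * k + (8 - 6)))"
    unfolding u_def power_Suc[symmetric] by (intro ext nat_pow) (simp add: power2_eq_square algebra_simps)
  also have "(\<Sum>k. x * x ^ (8 * k\<^sup>2 + 6 * k)) = x * (\<Sum>k. x ^ (8 * k\<^sup>2 + 6 * k))"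
    by (intro suminf_mult le_geometric) simp
  also have "(\<Sum>k. x * x ^ (8 * k\<^sup>2 + (16 - 6) * k + (8 - 6))) = x * (\<Sum>k. x ^ (8 * k\<^sup>2 + (16 - 6) * k + (8 - 6)))"
    by (intro suminf_mult le_geometric) simp
  also note distrib_left[symmetric]
  also note F[of 6, symmetric]
  finally show "(\<Prod>i. 1 - x ^ (4 * i + 4)) * (E 1 - E (- 1)) =
      2 * x * ((\<Prod>i. 1 - x ^ (16 * i + 16)) * ((\<Prod>i. 1 + x ^ (16 * i + 14)) * (\<Prod>i. 1 + x ^ (16 * i + 2))))"
    by simp
qed

section \<open>Counting square-zero matrices\<close>

unbundle no vec_syntax
hide_type (open) Finite_Cartesian_Product.vec

section \<open>Finiteness, kernels and the sets to be counted\<close>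

lemma finite_carrier_mat: "finite (carrier_mat m n :: 'a::finite mat set)"
proof (rule finite_subset)
  show "carrier_mat m n \<subseteq> (\<lambda>f. Matrix.mat m n f) ` (({0..<m} \<times> {0..<n}) \<rightarrow>\<^sub>E (UNIV :: 'a set))"
  proof
    fix A :: "'a mat" assume "A \<in> carrier_mat m n"
    then have eq: "A = Matrix.mat m n (restrict (\<lambda>ij. A $$ ij) ({0..<m} \<times> {0..<n}))"
      by (intro eq_matI) auto
    show "A \<in> (\<lambda>f. Matrix.mat m n f) ` (({0..<m} \<times> {0..<n}) \<rightarrow>\<^sub>E UNIV)"
      by (rule image_eqI, rule eq) auto
  qed
qed (intro finite_imageI finite_PiE, auto)

lemma bij_betw_vec_of_fun:
  "bij_betw (\<lambda>f. Matrix.vec n f) ({0..<n} \<rightarrow>\<^sub>E (UNIV :: 'a set)) (carrier_vec n)"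
proof (rule bij_betw_byWitness[where f' = "\<lambda>v. restrict (\<lambda>i. v $ i) {0..<n}"])
  show "\<forall>f\<in>{0..<n} \<rightarrow>\<^sub>E UNIV. restrict (\<lambda>i. Matrix.vec n f $ i) {0..<n} = (f :: nat \<Rightarrow> 'a)"
    by (auto simp: fun_eq_iff PiE_def extensional_def)
qed auto

lemma card_carrier_vec: "card (carrier_vec n :: 'a::finite vec set) = CARD('a) ^ n"
  by (simp add: bij_betw_same_card[OF bij_betw_vec_of_fun, symmetric] card_PiE)

lemma finite_carrier_vec: "finite (carrier_vec n :: 'a::finite vec set)"
  by (rule card_ge_0_finite) (simp add: card_carrier_vec)

text \<open>The size of the kernel stands in for the rank: \<open>c = q\<^bsup>n - rank N\<^esup>\<close> below.\<close>

definition mat_ker :: "nat \<Rightarrow> 'a::semiring_0 mat \<Rightarrow> 'a vec set" where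
  "mat_ker n N = {v \<in> carrier_vec n. N *\<^sub>v v = 0\<^sub>v n}"

definition sq_zero_mats :: "nat \<Rightarrow> nat \<Rightarrow> 'a::{finite,semiring_0} mat set" where
  "sq_zero_mats n c = {N \<in> carrier_mat n n. N * N = 0\<^sub>m n n \<and> card (mat_ker n N) = c}"

text \<open>Such an \<open>N\<close> maps \<open>v\<close> to \<open>w\<close> and \<open>w\<close>
  to 0, a Jordan chain of length two when w is nonzero.\<close>

definition chain_mats :: "nat \<Rightarrow> nat \<Rightarrow> 'a::{finite,semiring_0} vec \<Rightarrow> 'a vec \<Rightarrow> 'a mat set" where
  "chain_mats n c v w = {N \<in> sq_zero_mats n c. N *\<^sub>v v = w}"

section \<open>Change of basis for a Jordan chain\<close>

text \<open>An explicit basis completion. Independence of w and v yields rows i, j with a nonzero 2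
  by 2 minor; the columns w, v and the unit vectors of all other rows then form an invertible
  matrix.\<close>

lemma exists_invertible_two_columns:
  fixes v w :: "'a::field vec"
  assumes v: "v \<in> carrier_vec n" and w: "w \<in> carrier_vec n"
    and w0: "w \<noteq> 0\<^sub>v n" and indep: "\<And>c. v \<noteq> c \<cdot>\<^sub>v w"
  shows "\<exists>P\<in>carrier_mat n n. \<exists>Q\<in>carrier_mat n n. P * Q = 1\<^sub>m n \<and> Q * P = 1\<^sub>m n \<and>
    P *\<^sub>v unit_vec n 0 = w \<and> P *\<^sub>v unit_vec n 1 = v \<and> 2 \<le> n"
proof -
  obtain i j where ij: "i < n" "j < n" "w $ i * v $ j \<noteq> w $ j * v $ i"
  proof -
    obtain j where j: "j < n" "w $ j \<noteq> 0"
      using w w0 by (metis carrier_vecD eq_vecI index_zero_vec)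
    have "v \<noteq> (v $ j / w $ j) \<cdot>\<^sub>v w" by (rule indep)
    then obtain i where "i < n" "v $ i \<noteq> v $ j / w $ j * w $ i"
      using v w by (metis carrier_vecD eq_vecI index_smult_vec)
    with j that[of i j] show thesis by (auto simp: field_simps)
  qed
  then have "i \<noteq> j" by (auto simp: mult.commute)
  with ij(1,2) have n: "2 \<le> n" by linarith
  have "card {2..<n} = card ({..<n} - {i, j})"
    using ij(1,2) \<open>i \<noteq> j\<close> by (simp add: card_Diff_subset)
  \<comment> \<open>Column b \<ge> 2 of \<open>P\<close> will be the unit vector at row
    \<open>s b\<close>.\<close>
  then obtain s where s: "bij_betw s {2..<n} ({..<n} - {i, j})"
    by (metis finite_Diff finite_atLeastLessThan finite_lessThan finite_same_card_bij)
  define P where "P = Matrix.mat n n (\<lambda>(a, b). if b = 0 then w $ a else if b = 1 then v $ a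
    else if a = s b then 1 else 0)"
  have P: "P \<in> carrier_mat n n" by (simp add: P_def)
  have Pmult: "(P *\<^sub>v x) $ a = w $ a * x $ 0 + v $ a * x $ 1 + (\<Sum>b\<in>{2..<n}. if a = s b then x $ b else 0)"
    if "x \<in> carrier_vec n" "a < n" for x a
  proof -
    have "(P *\<^sub>v x) $ a = (\<Sum>b\<in>{0..<n}. P $$ (a, b) * x $ b)"
      using that P by (simp add: scalar_prod_def)
    also have "{0..<n} = {0, 1} \<union> {2..<n}" using n by auto
    also have "(\<Sum>b\<in>\<dots>. P $$ (a, b) * x $ b) =
        (\<Sum>b\<in>{0, 1}. P $$ (a, b) * x $ b) + (\<Sum>b\<in>{2..<n}. P $$ (a, b) * x $ b)"
      by (rule sum.union_disjoint) auto
    also have "(\<Sum>b\<in>{2..<n}. P $$ (a, b) * x $ b) = (\<Sum>b\<in>{2..<n}. if a = s b then x $ b else 0)"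
      using that by (intro sum.cong) (auto simp: P_def)
    finally show ?thesis using that n by (simp add: P_def)
  qed
  have outside: "(\<Sum>b\<in>{2..<n}. if a = s b then x $ b else 0) = 0" if "a = i \<or> a = j" for a and x :: "'a vec"
    using bij_betwE[OF s] that by (intro sum.neutral) auto
  have "det P \<noteq> 0"
  proof
    assume "det P = 0"
    then obtain x where x: "x \<in> carrier_vec n" "x \<noteq> 0\<^sub>v n" "P *\<^sub>v x = 0\<^sub>v n"
      using det_0_iff_vec_prod_zero[OF P] by auto
    have eq: "w $ a * x $ 0 + v $ a * x $ 1 + (\<Sum>b\<in>{2..<n}. if a = s b then x $ b else 0) = 0" if "a < n" for a
      using Pmult[OF x(1) that] x(3) that by simp
    \<comment> \<open>Rows i and j meet only the first two columns, so x_0 and x_1 solve a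
      homogeneous 2 by 2 system and vanish by Cramer's rule. Row \<open>s b\<close> then gives x_b =
      0.\<close>
    have i: "w $ i * x $ 0 + v $ i * x $ 1 = 0" and j: "w $ j * x $ 0 + v $ j * x $ 1 = 0"
      using eq[of i] eq[of j] outside ij(1,2) by simp_all
    have "x $ 0 * (w $ i * v $ j - w $ j * v $ i) =
        v $ j * (w $ i * x $ 0 + v $ i * x $ 1) - v $ i * (w $ j * x $ 0 + v $ j * x $ 1)"
      by (simp add: algebra_simps)
    then have x0: "x $ 0 = 0" using i j ij(3) by simp
    have "x $ 1 * (w $ i * v $ j - w $ j * v $ i) =
        w $ i * (w $ j * x $ 0 + v $ j * x $ 1) - w $ j * (w $ i * x $ 0 + v $ i * x $ 1)"
      by (simp add: algebra_simps)
    then have x1: "x $ 1 = 0" using i j ij(3) by simp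
    have "x $ b = 0" if "b \<in> {2..<n}" for b
    proof -
      have "(\<Sum>c\<in>{2..<n}. if s b = s c then x $ c else 0) = (\<Sum>c\<in>{2..<n}. if b = c then x $ c else 0)"
        using bij_betw_imp_inj_on[OF s] that by (intro sum.cong) (auto dest: inj_onD)
      then show ?thesis
        using eq[of "s b"] bij_betwE[OF s] that x0 x1 by auto
    qed
    then have "x = 0\<^sub>v n"
    proof (intro eq_vecI)
      fix a assume "a < dim_vec (0\<^sub>v n :: 'a vec)"
      moreover from this have "a = 0 \<or> a = 1 \<or> a \<in> {2..<n}" by auto
      ultimately show "x $ a = 0\<^sub>v n $ a"
        using \<open>\<And>b. b \<in> {2..<n} \<Longrightarrow> x $ b = 0\<close> x0 x1 by (metis index_zero_vec)
    qed (use x(1) in simp)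
    with x(2) show False ..
  qed
  then obtain Q where Q: "Q \<in> carrier_mat n n" "P * Q = 1\<^sub>m n" "Q * P = 1\<^sub>m n"
    using det_non_zero_imp_unit[OF P, of "()"] by (auto simp: Units_def ring_mat_def)
  have "P *\<^sub>v unit_vec n 0 = w" "P *\<^sub>v unit_vec n 1 = v"
  proof -
    have "(\<Sum>b\<in>{2..<n}. if a = s b then unit_vec n c $ b else 0) = (0 :: 'a)" if "c < 2" for a c
      using that by (intro sum.neutral) auto
    then show "P *\<^sub>v unit_vec n 0 = w" "P *\<^sub>v unit_vec n 1 = v"
      using P v w n by (auto intro!: eq_vecI simp del: index_mult_mat_vec simp add: Pmult)
  qed
  with P Q n show ?thesis
    by (intro bexI[of _ P] bexI[of _ Q] conjI) assumption+
qed

text \<open>Inner factors \<open>P * Q\<close> cancel in products, and v \<mapsto> P v maps the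
  kernel of the conjugate onto the kernel of \<open>N\<close>, with inverse v \<mapsto> Q v.\<close>

lemma
  fixes N P Q :: "'a::field mat"
  assumes N: "N \<in> carrier_mat n n" and P: "P \<in> carrier_mat n n" and Q: "Q \<in> carrier_mat n n"
    and PQ: "P * Q = 1\<^sub>m n" and QP: "Q * P = 1\<^sub>m n"
  shows conj_sq_zero: "N * N = 0\<^sub>m n n \<Longrightarrow> (Q * N * P) * (Q * N * P) = 0\<^sub>m n n"
    and conj_inverse: "P * (Q * N * P) * Q = N"
    and card_mat_ker_conj: "card (mat_ker n (Q * N * P)) = card (mat_ker n N)"
proof -
  have "(Q * N * P) * (Q * N * P) = Q * N * (P * Q) * N * P"
    using N P Q by (simp add: assoc_mult_mat[of _ n n _ n _ n])
  also have "\<dots> = Q * (N * N) * P"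
    using N P Q by (simp add: PQ assoc_mult_mat[of _ n n _ n _ n])
  finally show "(Q * N * P) * (Q * N * P) = 0\<^sub>m n n" if "N * N = 0\<^sub>m n n"
    using that P Q by simp
  have "P * (Q * N * P) * Q = (P * Q) * N * (P * Q)"
    using N P Q by (simp add: assoc_mult_mat[of _ n n _ n _ n])
  then show "P * (Q * N * P) * Q = N"
    using N by (simp add: PQ)
  have vec: "A *\<^sub>v (B *\<^sub>v x) = (A * B) *\<^sub>v x" if "A \<in> carrier_mat n n" "B \<in> carrier_mat n n" "x \<in> carrier_vec n" for A B :: "'a mat" and x
    using assoc_mult_mat_vec[OF that] by simp
  have zero: "A *\<^sub>v 0\<^sub>v n = 0\<^sub>v n" if "A \<in> carrier_mat n n" for A :: "'a mat"
    using that by (intro eq_vecI) (auto simp: scalar_prod_def)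
  have triple: "Q * N * P *\<^sub>v x = Q *\<^sub>v (N *\<^sub>v (P *\<^sub>v x))" if "x \<in> carrier_vec n" for x
    by (simp only: assoc_mult_mat_vec[OF mult_carrier_mat[OF Q N] P that]
        assoc_mult_mat_vec[OF Q N mult_mat_vec_carrier[OF P that]])
  have "bij_betw (\<lambda>v. P *\<^sub>v v) (mat_ker n (Q * N * P)) (mat_ker n N)"
  proof (rule bij_betw_byWitness[where f' = "\<lambda>v. Q *\<^sub>v v"])
    show "\<forall>a\<in>mat_ker n (Q * N * P). Q *\<^sub>v (P *\<^sub>v a) = a"
      using P Q by (auto simp: mat_ker_def vec QP simp del: assoc_mult_mat_vec)
    show "\<forall>a\<in>mat_ker n N. P *\<^sub>v (Q *\<^sub>v a) = a"
      using P Q by (auto simp: mat_ker_def vec PQ simp del: assoc_mult_mat_vec)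
    show "(\<lambda>v. P *\<^sub>v v) ` mat_ker n (Q * N * P) \<subseteq> mat_ker n N"
    proof (rule image_subsetI)
      fix x assume "x \<in> mat_ker n (Q * N * P)"
      then have x: "x \<in> carrier_vec n" "Q *\<^sub>v (N *\<^sub>v (P *\<^sub>v x)) = 0\<^sub>v n"
        using triple by (auto simp: mat_ker_def)
      then have "(P * Q) *\<^sub>v (N *\<^sub>v (P *\<^sub>v x)) = 0\<^sub>v n"
        using zero[OF P] N P Q by simp
      then show "P *\<^sub>v x \<in> mat_ker n N"
        using N P x by (simp add: PQ mat_ker_def)
    qed
    show "(\<lambda>v. Q *\<^sub>v v) ` mat_ker n N \<subseteq> mat_ker n (Q * N * P)"
    proof (rule image_subsetI)
      fix x assume "x \<in> mat_ker n N"
      then have x: "x \<in> carrier_vec n" "N *\<^sub>v x = 0\<^sub>v n"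
        by (auto simp: mat_ker_def)
      have "Q * N * P *\<^sub>v (Q *\<^sub>v x) = Q *\<^sub>v (N *\<^sub>v ((P * Q) *\<^sub>v x))"
        using x Q P by (simp add: triple)
      then show "Q *\<^sub>v x \<in> mat_ker n (Q * N * P)"
        using zero[OF Q] Q x by (simp add: PQ mat_ker_def)
    qed
  qed
  then show "card (mat_ker n (Q * N * P)) = card (mat_ker n N)"
    by (rule bij_betw_same_card)
qed

lemma conj_chain_mats:
  fixes N P Q :: "'a::{finite,field} mat"
  assumes P: "P \<in> carrier_mat n n" and Q: "Q \<in> carrier_mat n n"
    and PQ: "P * Q = 1\<^sub>m n" and QP: "Q * P = 1\<^sub>m n"
    and v: "v \<in> carrier_vec n" "P *\<^sub>v v = v'" and w: "w \<in> carrier_vec n" "P *\<^sub>v w = w'"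
    and N: "N \<in> chain_mats n c v' w'"
  shows "Q * N * P \<in> chain_mats n c v w"
proof -
  have N': "N \<in> carrier_mat n n" "N * N = 0\<^sub>m n n" "card (mat_ker n N) = c" "N *\<^sub>v v' = w'"
    using N by (auto simp: chain_mats_def sq_zero_mats_def)
  have "(Q * N * P) *\<^sub>v v = Q *\<^sub>v (N *\<^sub>v (P *\<^sub>v v))"
    using N'(1) P Q v(1) by (simp add: assoc_mult_mat[of _ n n _ n _ n] assoc_mult_mat_vec[of _ n n _ n])
  also have "\<dots> = (Q * P) *\<^sub>v w"
    using N' v P Q w by simp
  also have "\<dots> = w" using w by (simp add: QP)
  finally show ?thesis
    using N' P Q conj_sq_zero[OF N'(1) P Q PQ QP] card_mat_ker_conj[OF N'(1) P Q PQ QP]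
    by (auto simp: chain_mats_def sq_zero_mats_def)
qed

lemma finite_sq_zero_mats: "finite (sq_zero_mats n c)"
  by (rule finite_subset[OF _ finite_carrier_mat[of n n]]) (auto simp: sq_zero_mats_def)

lemma finite_chain_mats: "finite (chain_mats n c v w)"
  by (rule finite_subset[OF _ finite_sq_zero_mats[of n c]]) (auto simp: chain_mats_def)

text \<open>Conjugating by a basis change that takes the first two unit vectors to w and v is a
  bijection, so the count is the same for every independent pair.\<close>

lemma card_chain_mats_unit_vec:
  fixes v w :: "'a::{finite,field} vec"
  assumes v: "v \<in> carrier_vec n" and w: "w \<in> carrier_vec n"
    and w0: "w \<noteq> 0\<^sub>v n" and indep: "\<And>c. v \<noteq> c \<cdot>\<^sub>v w"
  shows "card (chain_mats n c v w) = card (chain_mats n c (unit_vec n 1) (unit_vec n 0 :: 'a vec))"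
proof -
  obtain P Q where P: "P \<in> carrier_mat n n" and Q: "Q \<in> carrier_mat n n"
    and PQ: "P * Q = 1\<^sub>m n" and QP: "Q * P = 1\<^sub>m n"
    and Pw: "P *\<^sub>v unit_vec n 0 = w" and Pv: "P *\<^sub>v unit_vec n 1 = v" and "2 \<le> n"
    using exists_invertible_two_columns[OF assms] by blast
  have Qw: "Q *\<^sub>v w = unit_vec n 0" "Q *\<^sub>v v = unit_vec n 1"
    using assoc_mult_mat_vec[OF Q P] by (simp_all flip: Pw Pv add: QP)
  have "bij_betw (\<lambda>N. Q * N * P) (chain_mats n c v w) (chain_mats n c (unit_vec n 1) (unit_vec n 0))"
  proof (rule bij_betw_byWitness[where f' = "\<lambda>N. P * N * Q"])
    show "\<forall>N\<in>chain_mats n c v w. P * (Q * N * P) * Q = N"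
      by (auto simp: chain_mats_def sq_zero_mats_def intro!: conj_inverse[OF _ P Q PQ QP])
    show "\<forall>N\<in>chain_mats n c (unit_vec n 1) (unit_vec n 0). Q * (P * N * Q) * P = N"
      by (auto simp: chain_mats_def sq_zero_mats_def intro!: conj_inverse[OF _ Q P QP PQ])
    show "(\<lambda>N. Q * N * P) ` chain_mats n c v w \<subseteq> chain_mats n c (unit_vec n 1) (unit_vec n 0)"
      using conj_chain_mats[OF P Q PQ QP _ Pv _ Pw] by auto
    show "(\<lambda>N. P * N * Q) ` chain_mats n c (unit_vec n 1) (unit_vec n 0) \<subseteq> chain_mats n c v w"
      using conj_chain_mats[OF Q P QP PQ v Qw(2) w Qw(1)] by auto
  qed
  then show ?thesis by (rule bij_betw_same_card)
qed

section \<open>Normal form of a square-zero matrix with a given chain\<close>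

definition jordan2 :: "'a::field mat" where
  "jordan2 = Matrix.mat 2 2 (\<lambda>(i, j). if i = 0 \<and> j = 1 then 1 else 0)"

text \<open>Placing \<open>a\<close> in the second row is deliberate: \<open>jordan2\<close> moves
  that row up, so J L has only a first row \<open>a\<close>, while L N has only a second row a
  N.\<close>

definition lower_row :: "nat \<Rightarrow> 'a::field vec \<Rightarrow> 'a mat" where
  "lower_row m a = Matrix.mat 2 m (\<lambda>(i, j). if i = 1 then a $ j else 0)"

text \<open>
  The upper right block is the general solution \<open>B\<close> of \<open>J B + B N = 0\<close> (for \<open>N\<^sup>2 = 0\<close>), with first row
  \<open>a\<close>; written as \<open>J L - L N\<close> it exhibits the matrix as a conjugate of \<open>diag(J, N)\<close>.
\<close>

definition chain_block :: "nat \<Rightarrow> 'a::field vec \<times> 'a mat \<Rightarrow> 'a mat" where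
  "chain_block m = (\<lambda>(a, N). four_block_mat jordan2 (jordan2 * lower_row m a - lower_row m a * N) (0\<^sub>m m 2) N)"

lemma jordan2_carrier [simp]: "jordan2 \<in> carrier_mat 2 2"
  and lower_row_carrier [simp]: "lower_row m a \<in> carrier_mat 2 m"
  by (simp_all add: jordan2_def lower_row_def)

lemma index_jordan2_mult:
  "B \<in> carrier_mat 2 m \<Longrightarrow> i < 2 \<Longrightarrow> j < m \<Longrightarrow> (jordan2 * B) $$ (i, j) = (if i = 0 then B $$ (1, j) else 0)"
  by (auto simp: jordan2_def scalar_prod_def numeral_2_eq_2 less_Suc_eq)

lemma index_lower_row_mult:
  "N \<in> carrier_mat m m \<Longrightarrow> i < 2 \<Longrightarrow> j < m \<Longrightarrow>
    (lower_row m a * N) $$ (i, j) = (if i = 0 then 0 else \<Sum>k<m. a $ k * N $$ (k, j))"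
  by (auto simp: lower_row_def scalar_prod_def numeral_2_eq_2 less_Suc_eq atLeast0LessThan intro!: sum.cong)

lemma jordan2_sq: "jordan2 * jordan2 = (0\<^sub>m 2 2 :: 'a::field mat)"
proof (rule eq_matI)
  fix i j assume "i < dim_row (0\<^sub>m 2 2 :: 'a mat)" "j < dim_col (0\<^sub>m 2 2 :: 'a mat)"
  then show "(jordan2 * jordan2) $$ (i, j) = (0\<^sub>m 2 2 :: 'a mat) $$ (i, j)"
    by (subst index_jordan2_mult[OF jordan2_carrier]) (auto simp: jordan2_def)
qed (simp_all add: jordan2_def)

lemma mult_upper_block_mat:
  fixes A1 :: "'a::semiring_0 mat"
  assumes "A1 \<in> carrier_mat n n" "B1 \<in> carrier_mat n m" "D1 \<in> carrier_mat m m"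
    and "A2 \<in> carrier_mat n n" "B2 \<in> carrier_mat n m" "D2 \<in> carrier_mat m m"
  shows "four_block_mat A1 B1 (0\<^sub>m m n) D1 * four_block_mat A2 B2 (0\<^sub>m m n) D2 =
    four_block_mat (A1 * A2) (A1 * B2 + B1 * D2) (0\<^sub>m m n) (D1 * D2)"
proof -
  have "four_block_mat A1 B1 (0\<^sub>m m n) D1 * four_block_mat A2 B2 (0\<^sub>m m n) D2 =
    four_block_mat (A1 * A2 + B1 * 0\<^sub>m m n) (A1 * B2 + B1 * D2) (0\<^sub>m m n * A2 + D1 * 0\<^sub>m m n) (0\<^sub>m m n * B2 + D1 * D2)"
    by (rule mult_four_block_mat) (use assms in auto)
  also have "A1 * A2 + B1 * 0\<^sub>m m n = A1 * A2"
    using assms by (simp add: right_mult_zero_mat[OF assms(2)] right_add_zero_mat[of _ n n])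
  also have "0\<^sub>m m n * A2 + D1 * 0\<^sub>m m n = 0\<^sub>m m n"
    using assms by (simp add: right_mult_zero_mat[OF assms(3)] left_mult_zero_mat[OF assms(4)])
  also have "0\<^sub>m m n * B2 + D1 * D2 = D1 * D2"
    using assms by (simp add: left_mult_zero_mat[OF assms(5)] left_add_zero_mat[of _ m m])
  finally show ?thesis .
qed

text \<open>The unipotent matrices satisfy U s U t = U (s + t) for fixed \<open>a\<close>, so
  \<open>U 1 a\<close> and \<open>U (- 1) a\<close> are mutually inverse. The conjugation reduces
  squares and kernels of \<open>chain_block\<close> to those of the block diagonal matrix.\<close>

lemma
  fixes N :: "'a::field mat" and a :: "'a vec"
  assumes N: "N \<in> carrier_mat m m"
  defines "U \<equiv> (\<lambda>s a. four_block_mat (1\<^sub>m 2) (s \<cdot>\<^sub>m lower_row m a) (0\<^sub>m m 2) (1\<^sub>m m))"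
  shows chain_block_conj: "chain_block m (a, N) = U (- 1) a * four_block_mat jordan2 (0\<^sub>m 2 m) (0\<^sub>m m 2) N * U 1 a"
    and chain_block_conj_inverse: "U 1 a * U (- 1) a = 1\<^sub>m (2 + m)" "U (- 1) a * U 1 a = 1\<^sub>m (2 + m)"
    and chain_block_conj_carrier: "U s a \<in> carrier_mat (2 + m) (2 + m)"
proof -
  let ?L = "lower_row m a"
  have L: "s \<cdot>\<^sub>m ?L \<in> carrier_mat 2 m" for s by simp
  have LN: "- 1 \<cdot>\<^sub>m ?L * N \<in> carrier_mat 2 m" using mult_carrier_mat[OF L N] .
  have one_smult: "1 \<cdot>\<^sub>m ?L = ?L" by (intro eq_matI) auto
  have JL: "jordan2 * ?L \<in> carrier_mat 2 m" using mult_carrier_mat[OF jordan2_carrier lower_row_carrier] .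
  have "U (- 1) a * four_block_mat jordan2 (0\<^sub>m 2 m) (0\<^sub>m m 2) N =
      four_block_mat (1\<^sub>m 2 * jordan2) (1\<^sub>m 2 * 0\<^sub>m 2 m + - 1 \<cdot>\<^sub>m ?L * N) (0\<^sub>m m 2) (1\<^sub>m m * N)"
    unfolding U_def by (rule mult_upper_block_mat) (use N in auto)
  also have "\<dots> = four_block_mat jordan2 (- 1 \<cdot>\<^sub>m ?L * N) (0\<^sub>m m 2) N"
    unfolding left_mult_one_mat[OF jordan2_carrier] left_mult_one_mat[OF N]
      left_mult_one_mat[OF zero_carrier_mat[of 2 m]] left_add_zero_mat[OF LN] ..
  also have "\<dots> * U 1 a =
      four_block_mat (jordan2 * 1\<^sub>m 2) (jordan2 * (1 \<cdot>\<^sub>m ?L) + - 1 \<cdot>\<^sub>m ?L * N * 1\<^sub>m m) (0\<^sub>m m 2) (N * 1\<^sub>m m)"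
    unfolding U_def by (rule mult_upper_block_mat) (use N LN in auto)
  also have "\<dots> = four_block_mat jordan2 (jordan2 * ?L + - 1 \<cdot>\<^sub>m ?L * N) (0\<^sub>m m 2) N"
    unfolding right_mult_one_mat[OF jordan2_carrier] right_mult_one_mat[OF N] right_mult_one_mat[OF LN]
    unfolding one_smult ..
  also have "jordan2 * ?L + - 1 \<cdot>\<^sub>m ?L * N = jordan2 * ?L - ?L * N"
    unfolding mult_smult_assoc_mat[OF lower_row_carrier N]
    using JL mult_carrier_mat[OF lower_row_carrier N] by (intro eq_matI) auto
  finally show "chain_block m (a, N) = U (- 1) a * four_block_mat jordan2 (0\<^sub>m 2 m) (0\<^sub>m m 2) N * U 1 a"
    by (simp add: chain_block_def)
  have U: "U s a * U t a = U (s + t) a" for s t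
  proof -
    have "U s a * U t a = four_block_mat (1\<^sub>m 2 * 1\<^sub>m 2) (1\<^sub>m 2 * (t \<cdot>\<^sub>m ?L) + s \<cdot>\<^sub>m ?L * 1\<^sub>m m) (0\<^sub>m m 2) (1\<^sub>m m * 1\<^sub>m m)"
      unfolding U_def by (rule mult_upper_block_mat) auto
    also have "1\<^sub>m 2 * (t \<cdot>\<^sub>m ?L) + s \<cdot>\<^sub>m ?L * 1\<^sub>m m = (s + t) \<cdot>\<^sub>m ?L"
      unfolding left_mult_one_mat[OF L] right_mult_one_mat[OF L]
      by (intro eq_matI) (auto simp: lower_row_def algebra_simps)
    finally show ?thesis by (simp add: U_def)
  qed
  have "U 0 a = 1\<^sub>m (2 + m)"
    unfolding U_def by (rule eq_matI) (auto simp: lower_row_def)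
  then show "U 1 a * U (- 1) a = 1\<^sub>m (2 + m)" "U (- 1) a * U 1 a = 1\<^sub>m (2 + m)"
    by (simp_all only: U add.right_inverse add.left_inverse)
  show "U s a \<in> carrier_mat (2 + m) (2 + m)"
    unfolding U_def by (rule four_block_carrier_mat) simp_all
qed

text \<open>After conjugation the kernel is the product of the kernels of the two diagonal blocks,
  and that of \<open>jordan2\<close> is the line of vectors (s, 0).\<close>

lemma card_mat_ker_chain_block:
  fixes N :: "'a::{finite,field} mat"
  assumes N: "N \<in> carrier_mat m m"
  shows "card (mat_ker (2 + m) (chain_block m (a, N))) = CARD('a) * card (mat_ker m N)"
proof -
  let ?D = "four_block_mat jordan2 (0\<^sub>m 2 m) (0\<^sub>m m 2) N"
  have "card (mat_ker (2 + m) (chain_block m (a, N))) = card (mat_ker (2 + m) ?D)"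
    unfolding chain_block_conj[OF N]
    by (rule card_mat_ker_conj[OF four_block_carrier_mat[OF jordan2_carrier N]
          chain_block_conj_carrier[OF N] chain_block_conj_carrier[OF N] chain_block_conj_inverse[OF N]])
  also have "\<dots> = card ((UNIV :: 'a set) \<times> mat_ker m N)"
  proof (rule bij_betw_same_card[symmetric])
    \<comment> \<open>\<open>?e s\<close> parametrises the kernel of \<open>jordan2\<close>, and
      also its image.\<close>
    let ?e = "\<lambda>s::'a. Matrix.vec 2 (\<lambda>i. if i = 0 then s else 0)"
    have J: "jordan2 *\<^sub>v x = ?e (x $ 1)" if "x \<in> carrier_vec 2" for x :: "'a vec"
      using that by (intro eq_vecI) (auto simp: jordan2_def scalar_prod_def numeral_2_eq_2)
    have D: "?D *\<^sub>v (x @\<^sub>v y) = ?e (x $ 1) @\<^sub>v (N *\<^sub>v y)" if "x \<in> carrier_vec 2" "y \<in> carrier_vec m" for x y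
    proof -
      have "?D *\<^sub>v (x @\<^sub>v y) = (jordan2 *\<^sub>v x + 0\<^sub>m 2 m *\<^sub>v y) @\<^sub>v (0\<^sub>m m 2 *\<^sub>v x + N *\<^sub>v y)"
        by (rule four_block_mat_mult_vec) (use N that in auto)
      moreover have "0\<^sub>m 2 m *\<^sub>v y = 0\<^sub>v 2" "0\<^sub>m m 2 *\<^sub>v x = 0\<^sub>v m"
        using that by (auto intro!: eq_vecI)
      ultimately show ?thesis
        using N that by (simp add: J)
    qed
    have zero: "0\<^sub>v (2 + m) = (0\<^sub>v 2 @\<^sub>v 0\<^sub>v m :: 'a vec)"
      by (intro eq_vecI) auto
    have dec: "?e (x $ 0) @\<^sub>v vec_last x m = x" "vec_last x m \<in> mat_ker m N" if "x \<in> mat_ker (2 + m) ?D" for x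
    proof -
      have x: "x \<in> carrier_vec (2 + m)" "?D *\<^sub>v x = 0\<^sub>v (2 + m)"
        using that by (auto simp: mat_ker_def)
      have split: "vec_first x 2 @\<^sub>v vec_last x m = x" by (rule vec_first_last_append[OF x(1)])
      have "?D *\<^sub>v (vec_first x 2 @\<^sub>v vec_last x m) = 0\<^sub>v 2 @\<^sub>v 0\<^sub>v m"
        using x(2) unfolding split zero .
      then have "?e (vec_first x 2 $ 1) @\<^sub>v (N *\<^sub>v vec_last x m) = 0\<^sub>v 2 @\<^sub>v 0\<^sub>v m"
        unfolding D[OF vec_first_carrier vec_last_carrier] .
      then have "?e (vec_first x 2 $ 1) = 0\<^sub>v 2 \<and> N *\<^sub>v vec_last x m = 0\<^sub>v m"
        by (subst (asm) append_vec_eq[where n = 2]) (rule vec_carrier zero_carrier_vec | assumption)+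
      then have "?e (vec_first x 2 $ 1) = 0\<^sub>v 2" and ker: "N *\<^sub>v vec_last x m = 0\<^sub>v m"
        by iprover+
      from this(1) have "?e (vec_first x 2 $ 1) $ 0 = 0" by simp
      then have "vec_first x 2 $ 1 = 0" by simp
      then have "vec_first x 2 = ?e (x $ 0)"
        using x by (intro eq_vecI) (auto simp: vec_first_def less_2_cases_iff)
      with split ker show "?e (x $ 0) @\<^sub>v vec_last x m = x" "vec_last x m \<in> mat_ker m N"
        by (simp_all add: mat_ker_def)
    qed
    have enc: "?e s @\<^sub>v y \<in> mat_ker (2 + m) ?D" if "y \<in> mat_ker m N" for s y
    proof -
      have y: "y \<in> carrier_vec m" "N *\<^sub>v y = 0\<^sub>v m" using that by (auto simp: mat_ker_def)
      have "?D *\<^sub>v (?e s @\<^sub>v y) = 0\<^sub>v (2 + m)"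
      proof -
        have "?e (?e s $ 1) = 0\<^sub>v 2" by (intro eq_vecI) auto
        then show ?thesis
          unfolding zero by (subst D) (use y in simp_all)
      qed
      moreover have "?e s @\<^sub>v y \<in> carrier_vec (2 + m)"
        using y by (intro append_carrier_vec) simp_all
      ultimately show ?thesis by (simp only: mat_ker_def mem_Collect_eq simp_thms)
    qed
    have proj: "(?e s @\<^sub>v y) $ 0 = s" "vec_last (?e s @\<^sub>v y) m = y" if "y \<in> mat_ker m N" for s y
      using that by (auto simp: vec_last_def mat_ker_def intro!: eq_vecI)
    show "bij_betw (\<lambda>(s, y). ?e s @\<^sub>v y) (UNIV \<times> mat_ker m N) (mat_ker (2 + m) ?D)"
    proof (rule bij_betw_byWitness[where f' = "\<lambda>x. (x $ 0, vec_last x m)"])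
      show "\<forall>p\<in>UNIV \<times> mat_ker m N. ((case p of (s, y) \<Rightarrow> ?e s @\<^sub>v y) $ 0, vec_last (case p of (s, y) \<Rightarrow> ?e s @\<^sub>v y) m) = p"
        by (clarify, simp only: proj split_conv)
      show "\<forall>x\<in>mat_ker (2 + m) ?D. (case (x $ 0, vec_last x m) of (s, y) \<Rightarrow> ?e s @\<^sub>v y) = x"
        by (clarify, simp only: dec split_conv)
      show "(\<lambda>(s, y). ?e s @\<^sub>v y) ` (UNIV \<times> mat_ker m N) \<subseteq> mat_ker (2 + m) ?D"
        by (clarify, rule enc)
      show "(\<lambda>x. (x $ 0, vec_last x m)) ` mat_ker (2 + m) ?D \<subseteq> UNIV \<times> mat_ker m N"
        by (clarify, intro conjI UNIV_I dec SigmaI)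
    qed
  qed
  finally show ?thesis by (simp add: card_cartesian_product)
qed

lemma upper_block_mat_eqD:
  assumes "four_block_mat A1 B1 C1 D1 = four_block_mat A2 B2 C2 D2"
    and "A1 \<in> carrier_mat n n" "B1 \<in> carrier_mat n m" "D1 \<in> carrier_mat m m"
    and "A2 \<in> carrier_mat n n" "B2 \<in> carrier_mat n m" "D2 \<in> carrier_mat m m"
  shows "B1 = B2" "D1 = D2"
proof -
  have eq: "four_block_mat A1 B1 C1 D1 $$ (i, j) = four_block_mat A2 B2 C2 D2 $$ (i, j)" for i j
    by (simp add: assms(1))
  show "B1 = B2"
  proof (rule eq_matI)
    fix i j assume "i < dim_row B2" "j < dim_col B2"
    then show "B1 $$ (i, j) = B2 $$ (i, j)" using eq[of i "n + j"] assms(2-) by simp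
  qed (use assms(2-) in auto)
  show "D1 = D2"
  proof (rule eq_matI)
    fix i j assume "i < dim_row D2" "j < dim_col D2"
    then show "D1 $$ (i, j) = D2 $$ (i, j)" using eq[of "n + i" "n + j"] assms(2-) by simp
  qed (use assms(2-) in auto)
qed

lemma chain_block_upper_carrier:
  "N \<in> carrier_mat m m \<Longrightarrow> jordan2 * lower_row m a - lower_row m a * N \<in> carrier_mat 2 m"
  by (intro minus_carrier_mat mult_carrier_mat[OF lower_row_carrier])

lemma index_chain_block_upper:
  assumes "N \<in> carrier_mat m m" "i < 2" "j < m"
  shows "(jordan2 * lower_row m a - lower_row m a * N) $$ (i, j) =
    (if i = 0 then a $ j else - (\<Sum>k<m. a $ k * N $$ (k, j)))"
proof -
  have "(jordan2 * lower_row m a - lower_row m a * N) $$ (i, j) =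
      (jordan2 * lower_row m a) $$ (i, j) - (lower_row m a * N) $$ (i, j)"
    using assms mult_carrier_mat[OF lower_row_carrier assms(1), of a] by (intro index_minus_mat) auto
  then show ?thesis
    using assms by (simp only: index_jordan2_mult[OF lower_row_carrier] index_lower_row_mult)
      (simp add: lower_row_def)
qed

lemma chain_block_carrier: "N \<in> carrier_mat m m \<Longrightarrow> chain_block m (a, N) \<in> carrier_mat (2 + m) (2 + m)"
  unfolding chain_block_def split_conv by (rule four_block_carrier_mat) simp_all

lemma mult_unit_vec:
  fixes N :: "'a::semiring_1 mat"
  assumes "N \<in> carrier_mat n n" "j < n"
  shows "N *\<^sub>v unit_vec n j = col N j"
  using assms by (intro eq_vecI) (simp_all add: scalar_prod_right_unit[of _ n])

lemma chain_block_sq_zero: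
  assumes N: "N \<in> carrier_mat m m" "N * N = 0\<^sub>m m m"
  shows "chain_block m (a, N) * chain_block m (a, N) = 0\<^sub>m (2 + m) (2 + m)"
proof -
  let ?D = "four_block_mat jordan2 (0\<^sub>m 2 m) (0\<^sub>m m 2) N"
  have z: "jordan2 * 0\<^sub>m 2 m + 0\<^sub>m 2 m * N = 0\<^sub>m 2 m"
    unfolding right_mult_zero_mat[OF jordan2_carrier] left_mult_zero_mat[OF N(1)] by simp
  have D: "?D * ?D = 0\<^sub>m (2 + m) (2 + m)"
    unfolding mult_upper_block_mat[OF jordan2_carrier zero_carrier_mat N(1) jordan2_carrier zero_carrier_mat N(1)]
      jordan2_sq z N(2) four_block_zero_mat ..
  show ?thesis
    unfolding chain_block_conj[OF N(1)]
    by (rule conj_sq_zero[OF four_block_carrier_mat[OF jordan2_carrier N(1)]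
          chain_block_conj_carrier[OF N(1)] chain_block_conj_carrier[OF N(1)] chain_block_conj_inverse[OF N(1)] D])
qed

lemma chain_block_mult_unit_vec:
  fixes N :: "'a::field mat"
  assumes N: "N \<in> carrier_mat m m"
  shows "chain_block m (a, N) *\<^sub>v unit_vec (2 + m) 1 = unit_vec (2 + m) 0"
proof -
  have "chain_block m (a, N) *\<^sub>v unit_vec (2 + m) 1 = col (chain_block m (a, N)) 1"
    by (rule mult_unit_vec[OF chain_block_carrier[OF N]]) simp
  also have "\<dots> = unit_vec (2 + m) 0"
    using N jordan2_carrier by (intro eq_vecI) (auto simp: chain_block_def jordan2_def)
  finally show ?thesis .
qed

text \<open>\<open>N\<close> is the lower right block, and \<open>a\<close> is the first row of the
  upper right block.\<close>

lemma inj_chain_block: "inj_on (chain_block m) (carrier_vec m \<times> carrier_mat m m)"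
proof (rule inj_onI, clarify)
  fix a b :: "'a::field vec" and N M :: "'a mat"
  assume ab: "a \<in> carrier_vec m" "b \<in> carrier_vec m" and NM: "N \<in> carrier_mat m m" "M \<in> carrier_mat m m"
    and "chain_block m (a, N) = chain_block m (b, M)"
  note eq = upper_block_mat_eqD[OF this(5)[unfolded chain_block_def split_conv] jordan2_carrier
      chain_block_upper_carrier[OF NM(1)] NM(1) jordan2_carrier chain_block_upper_carrier[OF NM(2)] NM(2)]
  have "a $ j = b $ j" if "j < m" for j
    using index_chain_block_upper[OF NM(1) pos2 that, of a] index_chain_block_upper[OF NM(2) pos2 that, of b] eq(1)
    by (simp del: index_minus_mat)
  then show "a = b \<and> N = M" using ab eq(2) by auto
qed

text \<open>Column 1 of \<open>N\<close> is e_0 by hypothesis, and column 0 is N e_0 = N^2 e_1 = 0.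
  This fixes the left blocks; squaring then gives D^2 = 0 and J B + B D = 0 for the right
  blocks.\<close>

lemma chain_block_surj:
  fixes N :: "'a::field mat"
  assumes N: "N \<in> carrier_mat (2 + m) (2 + m)" and sq: "N * N = 0\<^sub>m (2 + m) (2 + m)"
    and chain: "N *\<^sub>v unit_vec (2 + m) 1 = unit_vec (2 + m) 0"
  shows "\<exists>a\<in>carrier_vec m. \<exists>M\<in>carrier_mat m m. M * M = 0\<^sub>m m m \<and> N = chain_block m (a, M)"
proof -
  obtain A B C D where "split_block N 2 2 = (A, B, C, D)" by (metis prod_cases4)
  then have split: "A \<in> carrier_mat 2 2" "B \<in> carrier_mat 2 m" "C \<in> carrier_mat m 2" "D \<in> carrier_mat m m"
    "N = four_block_mat A B C D"
    by (rule split_block; use N in auto)+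
  have col1: "N $$ (i, 1) = (if i = 0 then 1 else 0)" if "i < 2 + m" for i
  proof -
    have "N $$ (i, 1) = col N 1 $ i" using N that by simp
    also have "col N 1 = unit_vec (2 + m) 0" using mult_unit_vec[OF N, of 1] chain by simp
    finally show ?thesis using that by simp
  qed
  have "N *\<^sub>v unit_vec (2 + m) 0 = (N * N) *\<^sub>v unit_vec (2 + m) 1"
    using chain by (subst assoc_mult_mat_vec[OF N N]) simp_all
  then have col0': "col N 0 = 0\<^sub>m (2 + m) (2 + m) *\<^sub>v unit_vec (2 + m) 1"
    using mult_unit_vec[OF N, of 0] sq by simp
  have col0: "N $$ (i, 0) = 0" if "i < 2 + m" for i
  proof -
    have "N $$ (i, 0) = col N 0 $ i" using N that by simp
    then show ?thesis unfolding col0' using that by (simp add: scalar_prod_def)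
  qed
  have A: "A = jordan2"
  proof (rule eq_matI)
    fix i j assume "i < dim_row (jordan2 :: 'a mat)" "j < dim_col (jordan2 :: 'a mat)"
    then have ij: "i < 2" "j < 2" by (simp_all add: jordan2_def)
    then have "A $$ (i, j) = N $$ (i, j)" using split by simp
    also have "\<dots> = jordan2 $$ (i, j)"
      using col0[of i] col1[of i] ij by (auto simp: jordan2_def less_2_cases_iff)
    finally show "A $$ (i, j) = jordan2 $$ (i, j)" .
  qed (use split in \<open>auto simp: jordan2_def\<close>)
  have C: "C = 0\<^sub>m m 2"
  proof (rule eq_matI)
    fix i j assume "i < dim_row (0\<^sub>m m 2 :: 'a mat)" "j < dim_col (0\<^sub>m m 2 :: 'a mat)"
    then have ij: "i < m" "j < 2" by simp_all
    then have "C $$ (i, j) = N $$ (2 + i, j)" using split by simp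
    also have "\<dots> = 0"
      using col0[of "2 + i"] col1[of "2 + i"] ij by (auto simp: less_2_cases_iff)
    finally show "C $$ (i, j) = 0\<^sub>m m 2 $$ (i, j)" using ij by simp
  qed (use split in auto)
  have eq: "four_block_mat (jordan2 * jordan2) (jordan2 * B + B * D) (0\<^sub>m m 2) (D * D) =
      four_block_mat (0\<^sub>m 2 2) (0\<^sub>m 2 m) (0\<^sub>m m 2) (0\<^sub>m m m)"
    using sq unfolding split(5) A C four_block_zero_mat
    by (subst (asm) mult_upper_block_mat) (use split in simp_all)
  have BD: "jordan2 * B + B * D \<in> carrier_mat 2 m"
    using mult_carrier_mat[OF split(2,4)] by (rule add_carrier_mat)
  note eqD = upper_block_mat_eqD[OF eq mult_carrier_mat[OF jordan2_carrier jordan2_carrier] BD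
      mult_carrier_mat[OF split(4,4)] zero_carrier_mat zero_carrier_mat zero_carrier_mat]
  have JB: "jordan2 * B + B * D = 0\<^sub>m 2 m" and DD: "D * D = 0\<^sub>m m m"
    by (rule eqD)+
  define a where "a = Matrix.row B 0"
  have a: "a \<in> carrier_vec m" using split by (auto simp: a_def)
  have "B = jordan2 * lower_row m a - lower_row m a * D"
  proof (rule eq_matI)
    fix i j assume "i < dim_row (jordan2 * lower_row m a - lower_row m a * D)"
      "j < dim_col (jordan2 * lower_row m a - lower_row m a * D)"
    then have ij: "i < 2" "j < m" using chain_block_upper_carrier[OF split(4), of a] by auto
    \<comment> \<open>The first row of J B is the second row of B, so the first row of the equation
      expresses the second row of B through the first.\<close>
    have "(jordan2 * B) $$ (0, j) + (B * D) $$ (0, j) = (jordan2 * B + B * D) $$ (0, j)"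
      using split ij by simp
    then have "B $$ (1, j) + (B * D) $$ (0, j) = 0"
      unfolding JB using index_jordan2_mult[OF split(2) pos2 ij(2)] ij by simp
    moreover have "(B * D) $$ (0, j) = (\<Sum>k<m. a $ k * D $$ (k, j))"
      using split ij by (simp add: scalar_prod_def a_def atLeast0LessThan)
    ultimately have "B $$ (1, j) = - (\<Sum>k<m. a $ k * D $$ (k, j))"
      by (simp add: eq_neg_iff_add_eq_0)
    moreover have "B $$ (0, j) = a $ j" using split ij by (simp add: a_def)
    ultimately show "B $$ (i, j) = (jordan2 * lower_row m a - lower_row m a * D) $$ (i, j)"
      unfolding index_chain_block_upper[OF split(4) ij] using ij by (auto simp: less_2_cases_iff)
  qed (use split chain_block_upper_carrier[OF split(4), of a] in auto)
  then have "N = chain_block m (a, D)"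
    by (simp add: chain_block_def split(5) A C)
  with a DD split(4) show ?thesis by auto
qed

text \<open>By the normal form there are q^m choices for the row and one square-zero corner; passing
  from the corner to the whole matrix multiplies the kernel size by q.\<close>

lemma card_chain_mats:
  fixes c :: nat
  shows "card (chain_mats (2 + m) (CARD('a) * c) (unit_vec (2 + m) 1) (unit_vec (2 + m) 0 :: 'a::{finite,field} vec)) =
    CARD('a) ^ m * card (sq_zero_mats m c :: 'a mat set)"
proof -
  have "bij_betw (chain_block m) (carrier_vec m \<times> (sq_zero_mats m c :: 'a mat set))
      (chain_mats (2 + m) (CARD('a) * c) (unit_vec (2 + m) 1) (unit_vec (2 + m) 0))"
  proof (rule bij_betw_imageI)
    show "inj_on (chain_block m) (carrier_vec m \<times> (sq_zero_mats m c :: 'a mat set))"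
      by (rule inj_on_subset[OF inj_chain_block]) (auto simp: sq_zero_mats_def)
    show "chain_block m ` (carrier_vec m \<times> (sq_zero_mats m c :: 'a mat set)) =
      chain_mats (2 + m) (CARD('a) * c) (unit_vec (2 + m) 1) (unit_vec (2 + m) 0)"
    proof (intro equalityI subsetI)
      fix X :: "'a mat" assume "X \<in> chain_block m ` (carrier_vec m \<times> sq_zero_mats m c)"
      then obtain a M where X: "X = chain_block m (a, M)" and M: "M \<in> carrier_mat m m" "M * M = 0\<^sub>m m m" "card (mat_ker m M) = c"
        by (auto simp: sq_zero_mats_def)
      show "X \<in> chain_mats (2 + m) (CARD('a) * c) (unit_vec (2 + m) 1) (unit_vec (2 + m) 0)"
        unfolding X chain_mats_def sq_zero_mats_def mem_Collect_eq card_mat_ker_chain_block[OF M(1)] M(3)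
        by (intro conjI chain_block_carrier chain_block_sq_zero chain_block_mult_unit_vec M refl)
    next
      fix X assume "X \<in> chain_mats (2 + m) (CARD('a) * c) (unit_vec (2 + m) 1) (unit_vec (2 + m) 0 :: 'a vec)"
      then have "X \<in> carrier_mat (2 + m) (2 + m)" "X * X = 0\<^sub>m (2 + m) (2 + m)"
        "X *\<^sub>v unit_vec (2 + m) 1 = unit_vec (2 + m) 0" and ker: "card (mat_ker (2 + m) X) = CARD('a) * c"
        unfolding chain_mats_def sq_zero_mats_def by blast+
      from chain_block_surj[OF this(1-3)] obtain a M where
        M: "a \<in> carrier_vec m" "M \<in> carrier_mat m m" "M * M = 0\<^sub>m m m" and X: "X = chain_block m (a, M)"
        by blast
      have "CARD('a) * card (mat_ker m M) = CARD('a) * c"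
        using ker unfolding X card_mat_ker_chain_block[OF M(2)] .
      then have "card (mat_ker m M) = c" by simp
      with M X show "X \<in> chain_block m ` (carrier_vec m \<times> sq_zero_mats m c)"
        by (auto simp: sq_zero_mats_def)
    qed
  qed
  then show ?thesis
    by (simp add: bij_betw_same_card[symmetric] card_cartesian_product card_carrier_vec)
qed

section \<open>Double counting and the recurrence\<close>

lemma mat_ker_full:
  fixes N :: "'a::{finite,field} mat"
  assumes N: "N \<in> carrier_mat n n" and "card (mat_ker n N) = CARD('a) ^ n"
  shows "N = 0\<^sub>m n n"
proof -
  have "mat_ker n N = carrier_vec n"
    by (rule card_subset_eq[OF finite_carrier_vec])
       (use assms(2) in \<open>auto simp: mat_ker_def card_carrier_vec\<close>)
  then have "unit_vec n j \<in> mat_ker n N" for j by simp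
  then have ker: "N *\<^sub>v unit_vec n j = 0\<^sub>v n" for j
    unfolding mat_ker_def by blast
  have "N $$ (i, j) = 0" if "i < n" "j < n" for i j
  proof -
    have "N $$ (i, j) = col N j $ i" using N that by simp
    also have "col N j = 0\<^sub>v n" using mult_unit_vec[OF N that(2)] ker by simp
    finally show ?thesis using that by simp
  qed
  then show ?thesis using N by (intro eq_matI) auto
qed

lemma mat_ker_zero: "mat_ker n (0\<^sub>m n n :: 'a::semiring_0 mat) = carrier_vec n"
  by (auto simp: mat_ker_def intro!: eq_vecI)

lemma sq_zero_mats_full: "sq_zero_mats n (CARD('a) ^ n) = {0\<^sub>m n n :: 'a::{finite,field} mat}"
  by (auto simp: sq_zero_mats_def mat_ker_zero card_carrier_vec intro: mat_ker_full)

text \<open>If v = c N v, applying N gives N v = c N^2 v = 0. Hence v and N v are independent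
  whenever N v is nonzero.\<close>

lemma sq_zero_chain:
  fixes N :: "'a::field mat"
  assumes N: "N \<in> carrier_mat n n" and sq: "N * N = 0\<^sub>m n n"
    and v: "v \<in> carrier_vec n" and nz: "N *\<^sub>v v \<noteq> 0\<^sub>v n"
  shows "v \<noteq> c \<cdot>\<^sub>v (N *\<^sub>v v)"
proof
  assume *: "v = c \<cdot>\<^sub>v (N *\<^sub>v v)"
  have "N *\<^sub>v v = N *\<^sub>v (c \<cdot>\<^sub>v (N *\<^sub>v v))"
    by (rule arg_cong[OF *, of "\<lambda>u. N *\<^sub>v u"])
  also have "\<dots> = c \<cdot>\<^sub>v ((N * N) *\<^sub>v v)"
    using N v by (simp add: mult_mat_vec[of _ n n])
  also have "\<dots> = 0\<^sub>v n"
    unfolding sq using v by (intro eq_vecI) auto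
  finally show False using nz by simp
qed

text \<open>Linearly independent pairs, listed with the image w first: w is nonzero and v lies off
  the line through w.\<close>

definition indep_pairs :: "nat \<Rightarrow> ('a::field vec \<times> 'a vec) set" where
  "indep_pairs n = (SIGMA w : carrier_vec n - {0\<^sub>v n}. carrier_vec n - range (\<lambda>c. c \<cdot>\<^sub>v w))"

lemma card_indep_pairs:
  "card (indep_pairs n :: ('a::{finite,field} vec \<times> 'a vec) set) = (CARD('a) ^ n - 1) * (CARD('a) ^ n - CARD('a))"
proof -
  have "card (carrier_vec n - range (\<lambda>c. c \<cdot>\<^sub>v w)) = CARD('a) ^ n - CARD('a)"
    if w: "w \<in> carrier_vec n" "w \<noteq> 0\<^sub>v n" for w :: "'a vec"
  proof -
    obtain j where j: "j < n" "w $ j \<noteq> 0"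
      using w by (metis carrier_vecD eq_vecI index_zero_vec)
    have "inj (\<lambda>c. c \<cdot>\<^sub>v w)"
    proof (rule injI)
      fix c d assume "c \<cdot>\<^sub>v w = d \<cdot>\<^sub>v w"
      then have "(c \<cdot>\<^sub>v w) $ j = (d \<cdot>\<^sub>v w) $ j" by simp
      then show "c = d" using j w by simp
    qed
    moreover have "range (\<lambda>c. c \<cdot>\<^sub>v w) \<subseteq> carrier_vec n" using w by auto
    ultimately show ?thesis
      by (simp add: card_Diff_subset card_image card_carrier_vec)
  qed
  then have "card (indep_pairs n :: ('a vec \<times> 'a vec) set) =
      (\<Sum>w\<in>carrier_vec n - {0\<^sub>v n :: 'a vec}. CARD('a) ^ n - CARD('a))"
    unfolding indep_pairs_def by (subst card_SigmaI) (auto simp: finite_carrier_vec intro!: sum.cong)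
  then show ?thesis
    by (simp add: card_Diff_singleton card_carrier_vec)
qed

text \<open>Pairs (N, v) with N v nonzero are counted twice. Each \<open>N\<close> admits q^n - c
  vectors v; conversely (N v, v) is an independent pair, and every independent pair arises from
  equally many \<open>N\<close>.\<close>

lemma card_sq_zero_mats_double_count:
  "card (sq_zero_mats n c :: 'a::{finite,field} mat set) * (CARD('a) ^ n - c) =
    (CARD('a) ^ n - 1) * (CARD('a) ^ n - CARD('a)) *
    card (chain_mats n c (unit_vec n 1) (unit_vec n 0 :: 'a vec))"
proof -
  let ?S = "SIGMA N : (sq_zero_mats n c :: 'a mat set). carrier_vec n - mat_ker n N"
  let ?T = "SIGMA p : indep_pairs n. (chain_mats n c (snd p) (fst p) :: 'a mat set)"
  have "card ?S = (\<Sum>N\<in>(sq_zero_mats n c :: 'a mat set). CARD('a) ^ n - c)"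
  proof (subst card_SigmaI)
    show "(\<Sum>N\<in>sq_zero_mats n c. card (carrier_vec n - mat_ker n (N :: 'a mat))) = (\<Sum>N\<in>(sq_zero_mats n c :: 'a mat set). CARD('a) ^ n - c)"
    proof (rule sum.cong[OF refl])
      fix N :: "'a mat" assume "N \<in> sq_zero_mats n c"
      moreover have "mat_ker n N \<subseteq> carrier_vec n" by (auto simp: mat_ker_def)
      ultimately show "card (carrier_vec n - mat_ker n N) = CARD('a) ^ n - c"
        using finite_subset[OF _ finite_carrier_vec, of "mat_ker n N"]
        by (simp add: card_Diff_subset card_carrier_vec sq_zero_mats_def)
    qed
  qed (auto simp: finite_sq_zero_mats finite_carrier_vec)
  moreover have "card ?T = (\<Sum>p\<in>(indep_pairs n :: ('a vec \<times> 'a vec) set). card (chain_mats n c (unit_vec n 1) (unit_vec n 0 :: 'a vec)))"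
  proof (subst card_SigmaI)
    show "(\<Sum>p\<in>indep_pairs n. card (chain_mats n c (snd p) (fst p) :: 'a mat set)) =
        (\<Sum>p\<in>(indep_pairs n :: ('a vec \<times> 'a vec) set). card (chain_mats n c (unit_vec n 1) (unit_vec n 0 :: 'a vec)))"
      by (intro sum.cong refl card_chain_mats_unit_vec) (auto simp: indep_pairs_def)
  qed (auto simp: indep_pairs_def finite_carrier_vec finite_chain_mats intro!: finite_SigmaI)
  moreover have "bij_betw (\<lambda>(N, v). ((N *\<^sub>v v, v), N)) ?S ?T"
  proof (rule bij_betw_byWitness[where f' = "\<lambda>((w, v), N). (N, v)"])
    show "(\<lambda>(N, v). ((N *\<^sub>v v, v), N)) ` ?S \<subseteq> ?T"
    proof (rule image_subsetI)
      fix p assume "p \<in> ?S"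
      then obtain N v where p: "p = (N, v)" and N: "N \<in> sq_zero_mats n c"
        and v: "v \<in> carrier_vec n" "v \<notin> mat_ker n (N :: 'a mat)"
        by blast
      then have N': "N \<in> carrier_mat n n" "N * N = 0\<^sub>m n n" and nz: "N *\<^sub>v v \<noteq> 0\<^sub>v n"
        by (auto simp: sq_zero_mats_def mat_ker_def)
      have "(N *\<^sub>v v, v) \<in> indep_pairs n"
        using sq_zero_chain[OF N' v(1) nz] N'(1) v(1) nz by (auto simp: indep_pairs_def)
      then show "(case p of (N, v) \<Rightarrow> ((N *\<^sub>v v, v), N)) \<in> ?T"
        using N by (simp add: p chain_mats_def)
    qed
    show "(\<lambda>((w, v), N). (N, v)) ` ?T \<subseteq> ?S"
      by (auto simp: chain_mats_def indep_pairs_def mat_ker_def)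
  qed (auto simp: chain_mats_def)
  ultimately show ?thesis
    by (simp add: bij_betw_same_card card_indep_pairs)
qed

lemma card_sq_zero_mats_rec:
  "card (sq_zero_mats (2 + m) (CARD('a) * c) :: 'a::{finite,field} mat set) * (CARD('a) ^ (2 + m) - CARD('a) * c) =
    (CARD('a) ^ (2 + m) - 1) * (CARD('a) ^ (2 + m) - CARD('a)) * (CARD('a) ^ m * card (sq_zero_mats m c :: 'a mat set))"
  unfolding card_sq_zero_mats_double_count card_chain_mats ..

text \<open>Here r and t are the numbers of Jordan blocks of size 2 and 1. If \<open>N\<close> is
  nonzero, some v with N v nonzero brings it to the form \<open>chain_block\<close>; the corner has
  size n - 2, and its kernel is smaller by a factor q.\<close>

lemma card_mat_ker_sq_zero:
  fixes N :: "'a::{finite,field} mat"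
  assumes "N \<in> carrier_mat n n" "N * N = 0\<^sub>m n n"
  shows "\<exists>r t. n = 2 * r + t \<and> card (mat_ker n N) = CARD('a) ^ (r + t)"
  using assms
proof (induction n arbitrary: N rule: less_induct)
  case (less n)
  show ?case
  proof (cases "N = 0\<^sub>m n n")
    case True
    then show ?thesis
      by (intro exI[of _ 0] exI[of _ n]) (simp add: mat_ker_zero card_carrier_vec)
  next
    case False
    then have "card (mat_ker n N) \<noteq> CARD('a) ^ n" using mat_ker_full less.prems(1) by blast
    then have "mat_ker n N \<noteq> carrier_vec n" by (auto simp: card_carrier_vec)
    then obtain v where v: "v \<in> carrier_vec n" and nz: "N *\<^sub>v v \<noteq> 0\<^sub>v n"
      by (auto simp: mat_ker_def)
    have w: "N *\<^sub>v v \<in> carrier_vec n" using less.prems(1) v by simp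
    obtain P Q where P: "P \<in> carrier_mat n n" and Q: "Q \<in> carrier_mat n n"
      and PQ: "P * Q = 1\<^sub>m n" and QP: "Q * P = 1\<^sub>m n"
      and Pw: "P *\<^sub>v unit_vec n 0 = N *\<^sub>v v" and Pv: "P *\<^sub>v unit_vec n 1 = v" and "2 \<le> n"
      using exists_invertible_two_columns[OF v w nz sq_zero_chain[OF less.prems v nz]] by blast
    obtain m where n: "n = 2 + m" using \<open>2 \<le> n\<close> by (auto simp: le_iff_add)
    let ?c = "card (mat_ker n N)"
    have "N \<in> chain_mats n ?c v (N *\<^sub>v v)"
      using less.prems by (simp add: chain_mats_def sq_zero_mats_def)
    from conj_chain_mats[OF P Q PQ QP unit_vec_carrier Pv unit_vec_carrier Pw this]
    have X: "Q * N * P \<in> chain_mats (2 + m) ?c (unit_vec (2 + m) 1) (unit_vec (2 + m) 0)"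
      unfolding n .
    then have "Q * N * P \<in> carrier_mat (2 + m) (2 + m)" "(Q * N * P) * (Q * N * P) = 0\<^sub>m (2 + m) (2 + m)"
        "(Q * N * P) *\<^sub>v unit_vec (2 + m) 1 = unit_vec (2 + m) 0"
      and ker: "card (mat_ker (2 + m) (Q * N * P)) = ?c"
      unfolding chain_mats_def sq_zero_mats_def by blast+
    from chain_block_surj[OF this(1-3)] obtain a M where
        M: "M \<in> carrier_mat m m" "M * M = 0\<^sub>m m m" and X: "Q * N * P = chain_block m (a, M)"
      by blast
    from less.IH[OF _ M] n obtain r t where rt: "m = 2 * r + t" "card (mat_ker m M) = CARD('a) ^ (r + t)"
      by auto
    have "?c = CARD('a) ^ (Suc r + t)"
      using ker unfolding X card_mat_ker_chain_block[OF M(1)] rt(2) by simp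
    then show ?thesis
      using n rt(1) by (intro exI[of _ "Suc r"] exI[of _ t]) simp
  qed
qed

lemma CARD_field_ge_2: "2 \<le> CARD('a::{finite,field})"
proof -
  have "card {0, 1 :: 'a} \<le> CARD('a)" by (rule card_mono) auto
  then show ?thesis by simp
qed

text \<open>Solves the recurrence by induction on r with t fixed; for r = 0 only the zero matrix
  remains. Each difference of powers of q is written as a power of q times some 1 - q^(-j), and
  these factors extend the \<open>qfact\<close> terms.\<close>

lemma card_sq_zero_mats:
  fixes r t :: nat
  defines "q \<equiv> real CARD('a::{finite,field})"
  shows "real (card (sq_zero_mats (2 * r + t) (CARD('a) ^ (r + t)) :: 'a mat set)) =
    q ^ (2 * r * (r + t)) * qfact (1 / q) (2 * r + t) / (qfact (1 / q) r * qfact (1 / q) t)"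
proof (induction r)
  case 0
  have "2 \<le> q" using CARD_field_ge_2[where 'a = 'a] by (simp add: q_def)
  then have "qfact (1 / q) t \<noteq> 0" using qfact_pos[of "1 / q" t] by simp
  then show ?case by (simp add: sq_zero_mats_full)
next
  case (Suc r)
  have q: "2 \<le> q" using CARD_field_ge_2[where 'a = 'a] by (simp add: q_def)
  then have y: "0 < 1 / q" "1 / q < 1" by auto
  define m where "m = 2 * r + t"
  let ?T = "real (card (sq_zero_mats (2 + m) (CARD('a) ^ (Suc r + t)) :: 'a mat set))"
  let ?I = "real (card (sq_zero_mats m (CARD('a) ^ (r + t)) :: 'a mat set))"
  have q1: "1 \<le> CARD('a)" using CARD_field_ge_2[where 'a = 'a] by simp
  \<comment> \<open>These inequalities allow the subtractions of the recurrence to pass from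
    naturals to reals.\<close>
  have le: "CARD('a) ^ (Suc r + t) \<le> CARD('a) ^ (2 + m)" "1 \<le> CARD('a) ^ (2 + m)" "CARD('a) ^ 1 \<le> CARD('a) ^ (2 + m)"
    using power_increasing[OF _ q1, of "Suc r + t" "2 + m"] one_le_power[OF q1, of "2 + m"]
      power_increasing[OF _ q1, of 1 "2 + m"] by (simp_all add: m_def)
  have "real (card (sq_zero_mats (2 + m) (CARD('a) * CARD('a) ^ (r + t)) :: 'a mat set) *
      (CARD('a) ^ (2 + m) - CARD('a) * CARD('a) ^ (r + t))) =
    real ((CARD('a) ^ (2 + m) - 1) * (CARD('a) ^ (2 + m) - CARD('a)) * (CARD('a) ^ m * card (sq_zero_mats m (CARD('a) ^ (r + t)) :: 'a mat set)))"
    by (simp only: card_sq_zero_mats_rec)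
  then have rec: "?T * (q ^ (2 + m) - q ^ (Suc r + t)) = (q ^ (2 + m) - 1) * (q ^ (2 + m) - q) * (q ^ m * ?I)"
    using le by (simp add: q_def of_nat_diff)
  have pow: "q ^ k * (1 - (1 / q) ^ Suc j) = q ^ k - q ^ l" if "k = Suc j + l" for j k l
    using q by (simp add: that power_add field_simps power_divide)
  have facts: "q ^ (2 + m) - q ^ (Suc r + t) = q ^ (2 + m) * (1 - (1 / q) ^ Suc r)"
    "q ^ (2 + m) - 1 = q ^ (2 + m) * (1 - (1 / q) ^ Suc (Suc m))"
    "q ^ (2 + m) - q = q ^ (2 + m) * (1 - (1 / q) ^ Suc m)"
    using pow[of "2 + m" r "Suc r + t"] pow[of "2 + m" "Suc m" 0] pow[of "2 + m" m 1] by (simp_all add: m_def)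
  have nz: "q ^ (2 + m) \<noteq> 0" "1 - (1 / q) ^ Suc r \<noteq> 0"
    using one_minus_power_pos[OF y, of r] q by auto
  have "q ^ (2 + m) * (?T * (1 - (1 / q) ^ Suc r)) =
      q ^ (2 + m) * ((1 - (1 / q) ^ Suc (Suc m)) * (1 - (1 / q) ^ Suc m) * q ^ (2 + m) * q ^ m * ?I)"
    using rec unfolding facts by (simp only: mult_ac)
  then have "?T * (1 - (1 / q) ^ Suc r) = (1 - (1 / q) ^ Suc (Suc m)) * (1 - (1 / q) ^ Suc m) * q ^ (2 + m) * q ^ m * ?I"
    by (rule mult_left_cancel[OF nz(1), THEN iffD1])
  then have "?T = (1 - (1 / q) ^ Suc (Suc m)) * (1 - (1 / q) ^ Suc m) * q ^ (2 + m) * q ^ m * ?I / (1 - (1 / q) ^ Suc r)"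
    using nz(2) by (metis nonzero_mult_div_cancel_right)
  also have "\<dots> = (q ^ (2 + m) * q ^ m * q ^ (2 * r * (r + t))) *
      (qfact (1 / q) m * (1 - (1 / q) ^ Suc m) * (1 - (1 / q) ^ Suc (Suc m))) /
      ((qfact (1 / q) r * (1 - (1 / q) ^ Suc r)) * qfact (1 / q) t)"
    unfolding Suc.IH[folded m_def] by (simp only: times_divide_eq_right times_divide_eq_left divide_divide_eq_left mult_ac)
  also have "q ^ (2 + m) * q ^ m * q ^ (2 * r * (r + t)) = q ^ (2 * Suc r * (Suc r + t))"
    unfolding power_add[symmetric] by (rule arg_cong[of _ _ "\<lambda>k. q ^ k"]) (simp add: m_def algebra_simps)
  finally show ?case
    by (simp only: qfact_Suc[symmetric] m_def) (simp add: qfact_Suc)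
qed

section \<open>From square-zero matrices to involutions\<close>

text \<open>In characteristic 2, (A + 1)^2 = A^2 + 1, and adding 1 twice does nothing, so A
  \<mapsto> A + 1 matches involutions with square-zero matrices. These are sorted by t, the number
  of Jordan blocks of size 1, with r = (n - t) / 2.\<close>

lemma card_involutions:
  assumes "(2 :: 'a::{finite,field}) = 0"
  defines "q \<equiv> real CARD('a)"
  shows "real (i_GL TYPE('a) n) = (\<Sum>t | t \<le> n \<and> even (n - t).
    q ^ ((n - t) * (n + t) div 2) * qfact (1 / q) n / (qfact (1 / q) ((n - t) div 2) * qfact (1 / q) t))"
proof -
  have two: "x + x = 0" for x :: 'a
    using assms by (simp flip: mult_2)
  have cancel: "A + 1\<^sub>m n + 1\<^sub>m n = A" if "A \<in> carrier_mat n n" for A :: "'a mat"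
    using that two by (intro eq_matI) (auto simp: add.assoc)
  have "bij_betw (\<lambda>A. A + 1\<^sub>m n) (involutions (GL TYPE('a) n)) {N \<in> carrier_mat n n. N * N = 0\<^sub>m n n}"
  proof (rule bij_betw_byWitness[where f' = "\<lambda>A. A + 1\<^sub>m n"])
    have sq: "(A + 1\<^sub>m n) * (A + 1\<^sub>m n) = A * A + 1\<^sub>m n" if A: "A \<in> carrier_mat n n" for A :: "'a mat"
    proof -
      have "(A + 1\<^sub>m n) * (A + 1\<^sub>m n) = A * (A + 1\<^sub>m n) + 1\<^sub>m n * (A + 1\<^sub>m n)"
        using A by (intro add_mult_distrib_mat[of _ n n _ _ n]) auto
      also have "\<dots> = (A * A + A) + (A + 1\<^sub>m n)"
        using A mult_add_distrib_mat[of A n n A n "1\<^sub>m n"] by simp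
      also have "\<dots> = A * A + 1\<^sub>m n"
      proof (rule eq_matI)
        fix i j assume ij: "i < dim_row (A * A + 1\<^sub>m n)" "j < dim_col (A * A + 1\<^sub>m n)"
        have "a + x + (x + b) = a + (x + x) + b" for a b x :: 'a
          by (simp only: add.assoc)
        then show "((A * A + A) + (A + 1\<^sub>m n)) $$ (i, j) = (A * A + 1\<^sub>m n) $$ (i, j)"
          using A ij by (simp add: two del: index_mult_mat(1))
      qed (use A in auto)
      finally show ?thesis .
    qed
    have one: "1\<^sub>m n + 1\<^sub>m n = (0\<^sub>m n n :: 'a mat)"
      using two by (intro eq_matI) auto
    have inv: "invertible_mat A" if "A \<in> carrier_mat n n" "A * A = 1\<^sub>m n" for A :: "'a mat"
      using that unfolding invertible_mat_def inverts_mat_def by (intro conjI exI[of _ A]) auto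
    show "(\<lambda>A. A + 1\<^sub>m n) ` involutions (GL TYPE('a) n) \<subseteq> {N \<in> carrier_mat n n. N * N = 0\<^sub>m n n}"
      by (auto simp: involutions_GL sq one)
    show "(\<lambda>A. A + 1\<^sub>m n) ` {N \<in> carrier_mat n n. N * N = 0\<^sub>m n n} \<subseteq> involutions (GL TYPE('a) n)"
      by (auto simp: involutions_GL sq intro!: inv)
  qed (auto simp: involutions_GL cancel)
  then have "i_GL TYPE('a) n = card {N \<in> carrier_mat n n. N * N = (0\<^sub>m n n :: 'a mat)}"
    unfolding i_GL_def by (rule bij_betw_same_card)
  also have "{N \<in> carrier_mat n n. N * N = (0\<^sub>m n n :: 'a mat)} =
      (\<Union>t\<in>{t. t \<le> n \<and> even (n - t)}. sq_zero_mats n (CARD('a) ^ ((n - t) div 2 + t)))"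
  proof (intro equalityI subsetI)
    fix N :: "'a mat" assume "N \<in> {N \<in> carrier_mat n n. N * N = 0\<^sub>m n n}"
    then have N: "N \<in> carrier_mat n n" "N * N = 0\<^sub>m n n" by auto
    with card_mat_ker_sq_zero[OF N] obtain r t where "n = 2 * r + t" "card (mat_ker n N) = CARD('a) ^ (r + t)"
      by auto
    with N show "N \<in> (\<Union>t\<in>{t. t \<le> n \<and> even (n - t)}. sq_zero_mats n (CARD('a) ^ ((n - t) div 2 + t)))"
      by (auto simp: sq_zero_mats_def intro!: exI[of _ t])
  qed (auto simp: sq_zero_mats_def)
  also have "card \<dots> = (\<Sum>t | t \<le> n \<and> even (n - t). card (sq_zero_mats n (CARD('a) ^ ((n - t) div 2 + t)) :: 'a mat set))"
  proof (rule card_UN_disjoint)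
    \<comment> \<open>Twice the kernel dimension is n + t, so different t give different kernel
      sizes and the union is disjoint.\<close>
    have inj: "s = t" if "s \<le> n" "even (n - s)" "t \<le> n" "even (n - t)"
      "CARD('a) ^ ((n - s) div 2 + s) = CARD('a) ^ ((n - t) div 2 + t)" for s t
    proof -
      have eq: "(n - s) div 2 + s = (n - t) div 2 + t"
        using that(5) CARD_field_ge_2[where 'a = 'a] by (subst (asm) power_inject_exp) auto
      have *: "2 * ((n - k) div 2 + k) = n + k" if "k \<le> n" "even (n - k)" for k
        using that by (auto elim!: evenE)
      from *[of s] *[of t] that have "2 * ((n - s) div 2 + s) = n + s" "2 * ((n - t) div 2 + t) = n + t"
        by auto
      with eq show ?thesis by simp
    qed
    show "\<forall>s\<in>{t. t \<le> n \<and> even (n - t)}. \<forall>t\<in>{t. t \<le> n \<and> even (n - t)}. s \<noteq> t \<longrightarrow>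
        sq_zero_mats n (CARD('a) ^ ((n - s) div 2 + s)) \<inter> (sq_zero_mats n (CARD('a) ^ ((n - t) div 2 + t)) :: 'a mat set) = {}"
    proof (intro ballI impI equals0I)
      fix s t and N :: "'a mat"
      assume st: "s \<in> {t. t \<le> n \<and> even (n - t)}" "t \<in> {t. t \<le> n \<and> even (n - t)}" and "s \<noteq> t"
        and N: "N \<in> sq_zero_mats n (CARD('a) ^ ((n - s) div 2 + s)) \<inter> sq_zero_mats n (CARD('a) ^ ((n - t) div 2 + t))"
      from N have "card (mat_ker n N) = CARD('a) ^ ((n - s) div 2 + s)" "card (mat_ker n N) = CARD('a) ^ ((n - t) div 2 + t)"
        unfolding sq_zero_mats_def by blast+
      then have "CARD('a) ^ ((n - s) div 2 + s) = CARD('a) ^ ((n - t) div 2 + t)"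
        by simp
      then have "s = t"
        using inj[of s t] st by blast
      with \<open>s \<noteq> t\<close> show False ..
    qed
  qed (simp_all add: finite_sq_zero_mats)
  finally have "real (i_GL TYPE('a) n) =
    (\<Sum>t | t \<le> n \<and> even (n - t). real (card (sq_zero_mats n (CARD('a) ^ ((n - t) div 2 + t)) :: 'a mat set)))"
    by simp
  also have "\<dots> = (\<Sum>t | t \<le> n \<and> even (n - t).
    q ^ ((n - t) * (n + t) div 2) * qfact (1 / q) n / (qfact (1 / q) ((n - t) div 2) * qfact (1 / q) t))"
  proof (rule sum.cong[OF refl])
    fix t assume "t \<in> {t. t \<le> n \<and> even (n - t)}"
    then have "t \<le> n" "even (n - t)" by auto
    then obtain r where r: "n - t = 2 * r" by (elim evenE)
    with \<open>t \<le> n\<close> have n: "n = 2 * r + t" by simp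
    have e: "(n - t) * (n + t) div 2 = 2 * r * (r + t)"
      unfolding n by (simp add: algebra_simps)
    then show "real (card (sq_zero_mats n (CARD('a) ^ ((n - t) div 2 + t)) :: 'a mat set)) =
      q ^ ((n - t) * (n + t) div 2) * qfact (1 / q) n / (qfact (1 / q) ((n - t) div 2) * qfact (1 / q) t)"
      using card_sq_zero_mats[where 'a = 'a, of r t]
      by (simp only: e) (simp add: r n q_def)
  qed
  finally show ?thesis .
qed

section \<open>The limits\<close>

text \<open>\<open>p\<close> selects even or odd n. Dividing by q^(n^2/2) leaves q^(-t^2/2) =
  x^(t^2), so Tannery's theorem gives the part of Euler's series with t of parity \<open>p\<close>,
  which is half the sum or difference of its values at 1 and -1.\<close>

lemma scaled_involutions_limit:
  fixes p :: bool
  assumes two: "(2 :: 'a::{finite,field}) = 0"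
  defines "q \<equiv> real CARD('a)"
  defines "x \<equiv> 1 / sqrt q"
  defines "F \<equiv> inf sequentially (principal {n. even n = p})"
  shows "((\<lambda>n. real (i_GL TYPE('a) n) / q powr (real n ^ 2 / 2)) \<longlongrightarrow>
    ((\<Prod>i. 1 + x ^ (2 * i + 1)) + (if p then 1 else - 1) * (\<Prod>i. 1 - x ^ (2 * i + 1))) / 2) F"
proof -
  have q: "2 \<le> q" using CARD_field_ge_2[where 'a = 'a] by (simp add: q_def)
  have y: "0 < 1 / q" "1 / q < 1" using q by auto
  have x2: "x\<^sup>2 = 1 / q" using q by (simp add: x_def power_divide)
  have x: "0 < x" "x < 1" using q by (simp_all add: x_def)
  have x_powr: "x = q powr (- 1 / 2)"
    using q by (simp add: x_def powr_minus_divide powr_half_sqrt)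
  define P where "P = (\<Prod>i. 1 - (1 / q) ^ Suc i)"
  have P: "P > 0" unfolding P_def by (rule qfact_limit_pos[OF y])
  \<comment> \<open>Extended by 0 to all t. For t \<le> n, evenness of n - t says that t and n have
    the same parity.\<close>
  define a where "a = (\<lambda>t n. if t \<le> n \<and> even (n - t) then
    qfact (1 / q) n / (qfact (1 / q) ((n - t) div 2) * qfact (1 / q) t) * x ^ t\<^sup>2 else 0)"
  define u where "u = (\<lambda>t. x ^ t\<^sup>2 / qfact (1 / q) t)"
  have ratio: "real (i_GL TYPE('a) n) / q powr (real n ^ 2 / 2) = (\<Sum>t. a t n)" for n
  proof -
    have exponent: "q ^ ((n - t) * (n + t) div 2) / q powr (real n ^ 2 / 2) = x ^ t\<^sup>2"
      if t: "t \<le> n" "even (n - t)" for t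
    proof -
      obtain r where "n - t = 2 * r" using t(2) by (elim evenE)
      then have n: "n = 2 * r + t" using t(1) by simp
      have e: "(n - t) * (n + t) div 2 = 2 * r * (r + t)"
        unfolding n by (simp add: algebra_simps)
      have "q ^ ((n - t) * (n + t) div 2) / q powr (real n ^ 2 / 2) =
          q powr (real (2 * r * (r + t)) - real n ^ 2 / 2)"
        unfolding e using q by (simp add: powr_diff powr_realpow del: of_nat_mult of_nat_add)
      also have "real (2 * r * (r + t)) - real n ^ 2 / 2 = (- 1 / 2) * real (t\<^sup>2)"
        unfolding n by (simp add: power2_eq_square field_simps)
      also have "q powr \<dots> = x ^ t\<^sup>2"
        unfolding x_powr using q by (simp only: powr_powr[symmetric]) (simp add: powr_realpow del: of_nat_power)
      finally show ?thesis .
    qed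
    have "real (i_GL TYPE('a) n) / q powr (real n ^ 2 / 2) = (\<Sum>t | t \<le> n \<and> even (n - t). a t n)"
      unfolding card_involutions[OF two] sum_divide_distrib q_def[symmetric]
    proof (rule sum.cong[OF refl])
      fix t assume "t \<in> {t. t \<le> n \<and> even (n - t)}"
      then have t: "t \<le> n" "even (n - t)" by auto
      then have "a t n = qfact (1 / q) n / (qfact (1 / q) ((n - t) div 2) * qfact (1 / q) t) *
          (q ^ ((n - t) * (n + t) div 2) / q powr (real n ^ 2 / 2))"
        unfolding exponent[OF t] by (simp add: a_def)
      then show "q ^ ((n - t) * (n + t) div 2) * qfact (1 / q) n / (qfact (1 / q) ((n - t) div 2) * qfact (1 / q) t) /
          q powr (real n ^ 2 / 2) = a t n"
        by simp
    qed
    also have "\<dots> = (\<Sum>t. a t n)"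
      by (rule suminf_finite[symmetric]) (auto simp: a_def)
    finally show ?thesis .
  qed
  \<comment> \<open>Both parities occur beyond any bound, as 2N and 2N + 1 show.\<close>
  have "F \<noteq> bot"
  proof
    assume "F = bot"
    then have "eventually (\<lambda>n. False) F" by simp
    then have "eventually (\<lambda>n. even n = p \<longrightarrow> False) sequentially"
      by (simp only: F_def eventually_inf_principal mem_Collect_eq)
    then obtain N :: nat where N: "\<forall>n\<ge>N. even n = p \<longrightarrow> False"
      unfolding eventually_sequentially ..
    show False
      using N[THEN spec, of "2 * N"] N[THEN spec, of "2 * N + 1"] by simp
  qed
  have F_le: "F \<le> sequentially" by (simp add: F_def)
  have lim: "((\<lambda>n. a t n) \<longlongrightarrow> (if even t = p then u t else 0)) F" for t
  proof (cases "even t = p")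
    case True
    \<comment> \<open>As (n - t) / 2 also tends to infinity, its \<open>qfact\<close> has the same
      limit \<open>P\<close> as the numerator, and \<open>P\<close> cancels.\<close>
    have "filterlim (\<lambda>n. (n - t) div 2) at_top sequentially"
      unfolding filterlim_at_top
    proof
      fix Z show "\<forall>\<^sub>F n in sequentially. Z \<le> (n - t) div 2"
        by (rule eventually_sequentiallyI[of "2 * Z + t"]) linarith
    qed
    then have "(\<lambda>n. qfact (1 / q) n / (qfact (1 / q) ((n - t) div 2) * qfact (1 / q) t) * x ^ t\<^sup>2)
        \<longlonglongrightarrow> P / (P * qfact (1 / q) t) * x ^ t\<^sup>2"
      unfolding P_def using P qfact_pos[OF y, of t]
      by (intro tendsto_intros qfact_tendsto[OF y] filterlim_compose[OF qfact_tendsto[OF y]]) (auto simp: P_def)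
    then have "((\<lambda>n. qfact (1 / q) n / (qfact (1 / q) ((n - t) div 2) * qfact (1 / q) t) * x ^ t\<^sup>2)
        \<longlongrightarrow> u t) F"
      using P by (intro tendsto_mono[OF F_le]) (simp add: u_def)
    moreover have "\<forall>\<^sub>F n in F. qfact (1 / q) n / (qfact (1 / q) ((n - t) div 2) * qfact (1 / q) t) * x ^ t\<^sup>2 = a t n"
      unfolding F_def eventually_inf_principal
      using eventually_ge_at_top[of t] by eventually_elim (use True in \<open>auto simp: a_def\<close>)
    ultimately show ?thesis using True by (simp add: tendsto_cong)
  next
    case False
    have "\<forall>\<^sub>F n in F. a t n = 0"
      unfolding F_def eventually_inf_principal
      by (rule always_eventually) (use False in \<open>auto simp: a_def\<close>)
    then show ?thesis using False by (simp add: tendsto_eventually)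
  qed
  \<comment> \<open>The factor \<open>1 ^ t\<close> gives the bound the shape of
    \<open>summable_theta\<close> with w = 1.\<close>
  have bound: "\<bar>a t n\<bar> \<le> 1 / P\<^sup>2 * (x ^ t\<^sup>2 * 1 ^ t)" for t n
  proof (cases "t \<le> n \<and> even (n - t)")
    case True
    then have "a t n = qfact (1 / q) n / (qfact (1 / q) ((n - t) div 2) * qfact (1 / q) t) * x ^ t\<^sup>2"
      by (simp only: a_def if_True simp_thms)
    then have "\<bar>a t n\<bar> = \<bar>qfact (1 / q) n / (qfact (1 / q) ((n - t) div 2) * qfact (1 / q) t)\<bar> * x ^ t\<^sup>2"
      using x by (simp add: abs_mult)
    also have "\<dots> \<le> 1 / P\<^sup>2 * x ^ t\<^sup>2"
      unfolding P_def using x by (intro mult_right_mono qfact_ratio_le[OF y]) auto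
    finally show ?thesis by simp
  next
    case False
    then show ?thesis using x by (auto simp: a_def)
  qed
  have "((\<lambda>n. \<Sum>t. a t n) \<longlongrightarrow> (\<Sum>t. if even t = p then u t else 0)) F"
    by (rule tannery_uniform(1)[OF lim bound summable_mult[OF summable_theta[OF x]] \<open>F \<noteq> bot\<close>])
  also have "(\<Sum>t. if even t = p then u t else 0) =
    ((\<Prod>i. 1 + x ^ (2 * i + 1)) + (if p then 1 else - 1) * (\<Prod>i. 1 - x ^ (2 * i + 1))) / 2"
  proof -
    let ?s = "if p then 1 else - 1 :: real"
    have sums: "(\<lambda>t. u t) sums (\<Prod>i. 1 + x ^ (2 * i + 1))"
      "(\<lambda>t. (- 1) ^ t * u t) sums (\<Prod>i. 1 - x ^ (2 * i + 1))"
      using summable_sums[OF summable_euler[OF x, of 1]] summable_sums[OF summable_euler[OF x, of "- 1"]]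
      unfolding euler_product_sum[OF x] unfolding x2 by (simp_all add: u_def mult.commute)
    have "(\<lambda>t. (u t + ?s * ((- 1) ^ t * u t)) / 2) sums
        (((\<Prod>i. 1 + x ^ (2 * i + 1)) + ?s * (\<Prod>i. 1 - x ^ (2 * i + 1))) / 2)"
      by (intro sums_divide sums_add sums_mult sums)
    also have "(\<lambda>t. (u t + ?s * ((- 1) ^ t * u t)) / 2) = (\<lambda>t. if even t = p then u t else 0)"
      by auto
    finally show ?thesis by (rule sums_unique[symmetric])
  qed
  finally show ?thesis unfolding ratio .
qed

text \<open>Translation by 1 permutes the field, so summing all elements before and after shows that
  the field size is 0 in the field; a vanishing power of 2 forces 2 = 0.\<close>

lemma two_eq_zero_of_CARD_power_2:
  assumes "CARD('a::{finite,field}) = 2 ^ k"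
  shows "(2 :: 'a) = 0"
proof -
  have "(\<Sum>x\<in>(UNIV :: 'a set). x) = (\<Sum>x\<in>(UNIV :: 'a set). x + 1)"
    by (rule sum.reindex_bij_witness[of _ "\<lambda>x. x + 1" "\<lambda>x. x - 1"]) auto
  also have "\<dots> = (\<Sum>x\<in>(UNIV :: 'a set). x) + of_nat CARD('a)"
    by (simp add: sum.distrib)
  finally have "of_nat CARD('a) = (0 :: 'a)" by simp
  then show ?thesis by (simp add: assms)
qed

text \<open>Convergence is asserted separately because \<open>prodinf\<close> is meaningful only for
  convergent products. Products start at index 0, hence \<open>Suc i\<close>; restricting
  \<open>sequentially\<close> to a parity class expresses the limits through even or odd n.\<close>

theorem theorem3p2:
  fixes q :: nat
  assumes "CARD('a::{field,finite}) = q"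
    and "\<exists>k\<ge>1. q = 2 ^ k"
  shows "convergent_prod (\<lambda>i. 1 + sqrt (real q) / real q ^ Suc i) \<and>
    convergent_prod (\<lambda>i. 1 - sqrt (real q) / real q ^ Suc i) \<and>
    convergent_prod (\<lambda>i. (1 + real q powi (5 - 8 * int (Suc i))) * (1 + real q powi (3 - 8 * int (Suc i)))
            * (1 - real q powi (- 8 * int (Suc i))) / (1 - real q powi (- 2 * int (Suc i)))) \<and>
    convergent_prod (\<lambda>i. (1 + real q powi (7 - 8 * int (Suc i))) * (1 + real q powi (1 - 8 * int (Suc i)))
            * (1 - real q powi (- 8 * int (Suc i))) / (1 - real q powi (- 2 * int (Suc i)))) \<and>
    (((\<lambda>n. real (i_GL TYPE('a) n) / real q powr (real n ^ 2 / 2)) \<longlongrightarrow>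
        1 / 2 * ((\<Prod>i. 1 + sqrt (real q) / real q ^ Suc i)
          + (\<Prod>i. 1 - sqrt (real q) / real q ^ Suc i)))
      (inf sequentially (principal {n. even n})) \<and>
     1 / 2 * ((\<Prod>i. 1 + sqrt (real q) / real q ^ Suc i)
          + (\<Prod>i. 1 - sqrt (real q) / real q ^ Suc i)) =
       (\<Prod>i. (1 + real q powi (5 - 8 * int (Suc i))) * (1 + real q powi (3 - 8 * int (Suc i)))
            * (1 - real q powi (- 8 * int (Suc i))) / (1 - real q powi (- 2 * int (Suc i))))) \<and>
    (((\<lambda>n. real (i_GL TYPE('a) n) / real q powr ((real n ^ 2 - 1) / 2)) \<longlongrightarrow>
        sqrt (real q) / 2 * ((\<Prod>i. 1 + sqrt (real q) / real q ^ Suc i)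
          - (\<Prod>i. 1 - sqrt (real q) / real q ^ Suc i)))
      (inf sequentially (principal {n. odd n})) \<and>
     sqrt (real q) / 2 * ((\<Prod>i. 1 + sqrt (real q) / real q ^ Suc i)
          - (\<Prod>i. 1 - sqrt (real q) / real q ^ Suc i)) =
       (\<Prod>i. (1 + real q powi (7 - 8 * int (Suc i))) * (1 + real q powi (1 - 8 * int (Suc i)))
            * (1 - real q powi (- 8 * int (Suc i))) / (1 - real q powi (- 2 * int (Suc i)))))"
proof -
  from assms obtain k where "CARD('a) = 2 ^ k" by auto
  then have two: "(2 :: 'a) = 0" by (rule two_eq_zero_of_CARD_power_2)
  have q: "2 \<le> real q" using CARD_field_ge_2[where 'a = 'a] assms(1) by simp
  \<comment> \<open>With x = q^(-1/2) every factor in the statement becomes a power of x: sqrt(q) /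
    q^(i+1) = x^(2i+1), and q^(-k) = x^(2k).\<close>
  define x where "x = 1 / sqrt (real q)"
  have x: "0 < x" "x < 1" using q by (simp_all add: x_def)
  have x2: "x\<^sup>2 = inverse (real q)" using q by (simp add: x_def power_divide field_simps)
  have sqrt_q: "sqrt (real q) = inverse x" by (simp add: x_def)
  have factor: "sqrt (real q) / real q ^ Suc i = x ^ (2 * i + 1)" for i
  proof -
    have "real q ^ Suc i = inverse x ^ (2 * Suc i)"
      unfolding power_mult using x2 by (simp add: power_inverse)
    then show ?thesis
      unfolding sqrt_q using x by (simp only: power_inverse) (simp add: field_simps)
  qed
  have powi: "real q powi e = x ^ m" if "e = - int k" "m = 2 * k" for e k m
    using that q by (simp add: x2 power_mult power_int_minus power_inverse)
  have powis: "real q powi (5 - 8 * int (Suc i)) = x ^ (16 * i + 6)"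
    "real q powi (3 - 8 * int (Suc i)) = x ^ (16 * i + 10)"
    "real q powi (7 - 8 * int (Suc i)) = x ^ (16 * i + 2)"
    "real q powi (1 - 8 * int (Suc i)) = x ^ (16 * i + 14)"
    "real q powi (- 8 * int (Suc i)) = x ^ (16 * i + 16)"
    "real q powi (- 2 * int (Suc i)) = x ^ (4 * i + 4)" for i
    by (rule powi[of _ "8 * i + 3"] powi[of _ "8 * i + 5"] powi[of _ "8 * i + 1"] powi[of _ "8 * i + 7"]
        powi[of _ "8 * i + 8"] powi[of _ "2 * i + 2"]; simp)+
  have plus: "convergent_prod (\<lambda>i. 1 + x ^ (a * i + b))" and minus: "convergent_prod (\<lambda>i. 1 - x ^ (a * i + b))"
    if "a > 0" for a b
    using convergent_prod_one_plus_powers[OF x that, of 1 b] convergent_prod_one_plus_powers[OF x that, of "- 1" b]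
    by simp_all
  define E where "E = (\<lambda>s. \<Prod>i. 1 + s * x ^ (2 * i + 1))"
  have E: "E 1 = (\<Prod>i. 1 + x ^ (2 * i + 1))" "E (- 1) = (\<Prod>i. 1 - x ^ (2 * i + 1))"
    by (simp_all add: E_def)
  define D where "D = (\<Prod>i. 1 - x ^ (4 * i + 4))"
  have "D \<noteq> 0"
    unfolding D_def
  proof (rule prodinf_nonzero[OF minus])
    show "1 - x ^ (4 * i + 4) \<noteq> 0" for i
      using one_minus_power_pos[OF x, of "4 * i + 3"] by (simp add: eval_nat_numeral)
  qed simp
  \<comment> \<open>Splits the right-hand products into the four separate products of the parity
    identities; a and b cover both parities.\<close>
  have quotient: "convergent_prod (\<lambda>i. (1 + x ^ (16 * i + a)) * (1 + x ^ (16 * i + b)) * (1 - x ^ (16 * i + 16)) / (1 - x ^ (4 * i + 4)))"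
    "(\<Prod>i. (1 + x ^ (16 * i + a)) * (1 + x ^ (16 * i + b)) * (1 - x ^ (16 * i + 16)) / (1 - x ^ (4 * i + 4))) =
      (\<Prod>i. 1 + x ^ (16 * i + a)) * (\<Prod>i. 1 + x ^ (16 * i + b)) * (\<Prod>i. 1 - x ^ (16 * i + 16)) / D" for a b
    unfolding D_def
    by (intro convergent_prod_divide convergent_prod_mult plus minus; simp)
      (simp add: prodinf_divide[symmetric] prodinf_mult[symmetric] convergent_prod_mult plus minus)
  have parts: "D * (E 1 + E (- 1)) =
      2 * ((\<Prod>i. 1 - x ^ (16 * i + 16)) * ((\<Prod>i. 1 + x ^ (16 * i + 10)) * (\<Prod>i. 1 + x ^ (16 * i + 6))))"
    "D * (E 1 - E (- 1)) =
      2 * x * ((\<Prod>i. 1 - x ^ (16 * i + 16)) * ((\<Prod>i. 1 + x ^ (16 * i + 14)) * (\<Prod>i. 1 + x ^ (16 * i + 2))))"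
    unfolding D_def E_def by (rule even_odd_part_product[OF x])+
  have even_id: "1 / 2 * (E 1 + E (- 1)) =
      (\<Prod>i. (1 + x ^ (16 * i + 6)) * (1 + x ^ (16 * i + 10)) * (1 - x ^ (16 * i + 16)) / (1 - x ^ (4 * i + 4)))"
    unfolding quotient(2) using parts(1) \<open>D \<noteq> 0\<close> by (simp add: field_simps)
  have odd_id: "inverse x / 2 * (E 1 - E (- 1)) =
      (\<Prod>i. (1 + x ^ (16 * i + 2)) * (1 + x ^ (16 * i + 14)) * (1 - x ^ (16 * i + 16)) / (1 - x ^ (4 * i + 4)))"
    unfolding quotient(2) using parts(2) \<open>D \<noteq> 0\<close> x by (simp add: field_simps)
  note lim = scaled_involutions_limit[where 'a = 'a, OF two, unfolded assms(1), folded x_def, folded E]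
  have even_lim: "((\<lambda>n. real (i_GL TYPE('a) n) / real q powr (real n ^ 2 / 2)) \<longlongrightarrow>
      1 / 2 * (E 1 + E (- 1))) (inf sequentially (principal {n. even n}))"
    using lim[of True] by simp
  \<comment> \<open>The odd normalisation differs from the even one by sqrt(q) = 1/x, the same
    factor that cancels the x in the odd-part identity.\<close>
  have "real q powr ((real n ^ 2 - 1) / 2) = real q powr (real n ^ 2 / 2) / sqrt (real q)" for n
    using q by (simp add: diff_divide_distrib powr_diff powr_half_sqrt)
  then have ratio: "real (i_GL TYPE('a) n) / real q powr ((real n ^ 2 - 1) / 2) =
      inverse x * (real (i_GL TYPE('a) n) / real q powr (real n ^ 2 / 2))" for n
    by (simp add: sqrt_q)
  have odd_lim: "((\<lambda>n. real (i_GL TYPE('a) n) / real q powr ((real n ^ 2 - 1) / 2)) \<longlongrightarrow>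
      inverse x / 2 * (E 1 - E (- 1))) (inf sequentially (principal {n. odd n}))"
    unfolding ratio using tendsto_mult_left[OF lim[of False], of "inverse x"] by simp
  show ?thesis
    unfolding factor powis unfolding sqrt_q E[symmetric]
    by (intro conjI plus minus quotient(1) even_lim even_id odd_lim odd_id) simp_all
qed

end
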